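(* Let $(W,S)$ be a Coxeter group of type $B_2$ with braid group $B=\langle s_1,s_2\mid (s_1s_2)^2=(s_2s_1)^2\rangle$, let $q\in\mathbb{C}$, and let $H^c_q$ be the cubic Hecke algebra, i.e. the quotient of the group algebra $\mathbb{C}[B]$ by the relations $(s-q)(s^2-1)=0$, $s\in S$. Then every representation of $H^c_q$ is good (as a representation of $B$) provided that $q^8\neq1$.
   Context: Let $\tau:W\to B$ be the canonical section given by reduced decompositions ($\tau(s)=s$ for $s\in S$, $\tau(ww')=\tau(w)\tau(w')$ when $\ell(ww')=\ell(w)+\ell(w')$). For a representation $V$ of $B$ put $V_s=(s^2-1)V$ for $s\in S$, and $$K_W(V)=\{(x_w)_{w\in W}\in V^W:\ x_{sw}-s\,x_w\in V_s\ \text{for all } s\in S,\ w\in W\}$$ (in the index, $s$ denotes the element of $W$; in $s\,x_w$ it denotes the generator of $B$). For $y\in W$ there is an embedding $i_y:V\to K_W(V)$, $i_y(v)=(\tau(wy^{-1})v)_{w\in W}$. The representation $V$ is called good if $K_W(V)$ is generated (spanned) by the subspaces $i_y(V)$, $y\in W$. *)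

theory Defs
  imports
    Complex_Main
    "HOL-Library.Poly_Mapping"
    "HOL-Library.Function_Algebras"
    "HOL-Algebra.QuotRing"
begin

section \<open>Groups given by a presentation\<close>

text \<open>
  A letter \<open>(g, True)\<close> stands for the generator \<open>g\<close>, a letter \<open>(g, False)\<close> for its inverse.
  A set \<open>R\<close> of pairs of words is read as a set of defining relations \<open>l = r\<close>.
\<close>

type_synonym 'g word = "('g \<times> bool) list"

inductive pres_cong :: "('g word \<times> 'g word) set \<Rightarrow> 'g word \<Rightarrow> 'g word \<Rightarrow> bool"
  for R :: "('g word \<times> 'g word) set" where
  pc_refl: "pres_cong R u u"
| pc_sym: "pres_cong R u v \<Longrightarrow> pres_cong R v u"
| pc_trans: "pres_cong R u v \<Longrightarrow> pres_cong R v w \<Longrightarrow> pres_cong R u w"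
| pc_cancel: "pres_cong R (u @ [(g, b), (g, \<not> b)] @ v) (u @ v)"
| pc_rel: "(l, r) \<in> R \<Longrightarrow> pres_cong R (u @ l @ v) (u @ r @ v)"

definition inv_word :: "'g word \<Rightarrow> 'g word" where
  "inv_word u = rev (map (\<lambda>(g, b). (g, \<not> b)) u)"

lemma pres_cong_equivp: "equivp (pres_cong R)"
  by (intro equivpI reflpI sympI transpI) (auto intro: pres_cong.intros)

lemma pres_cong_context: "pres_cong R u v \<Longrightarrow> pres_cong R (a @ u @ b) (a @ v @ b)"
proof (induction arbitrary: a b rule: pres_cong.induct)
  case (pc_cancel u g c v)
  show ?case using pres_cong.pc_cancel[of R "a @ u" g c "v @ b"] by simp
next
  case (pc_rel l r u v)
  then show ?case using pres_cong.pc_rel[of l r R "a @ u" "v @ b"] by simp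
next
  case (pc_trans u v w)
  then show ?case by (meson pres_cong.pc_trans)
qed (auto intro: pc_refl pc_sym)

lemma pres_cong_append:
  assumes "pres_cong R u u'" "pres_cong R v v'"
  shows "pres_cong R (u @ v) (u' @ v')"
  using pres_cong_context[OF assms(1), of "[]" v] pres_cong_context[OF assms(2), of u' "[]"]
  by (auto intro: pc_trans)

lemma inv_word_append: "inv_word (u @ v) = inv_word v @ inv_word u"
  by (simp add: inv_word_def)

lemma inv_word_inv_word: "inv_word (inv_word u) = u"
  by (simp add: inv_word_def rev_map o_def case_prod_beta)

lemma pres_cong_left_inv: "pres_cong R (inv_word u @ u) []"
proof (induction u)
  case Nil
  show ?case by (simp add: inv_word_def pc_refl)
next
  case (Cons a u)
  obtain g b where a: "a = (g, b)" by force
  have "pres_cong R (inv_word u @ [(g, \<not> b), (g, \<not> \<not> b)] @ u) (inv_word u @ u)"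
    by (rule pc_cancel)
  then show ?case using Cons by (auto simp: a inv_word_def intro: pc_trans)
qed

lemma pres_cong_right_inv: "pres_cong R (u @ inv_word u) []"
  using pres_cong_left_inv[of R "inv_word u"] by (simp add: inv_word_inv_word)

lemma pres_cong_inv_word:
  assumes "pres_cong R u v"
  shows "pres_cong R (inv_word u) (inv_word v)"
proof -
  have "pres_cong R (inv_word u @ u @ inv_word v) (inv_word v)"
    using pres_cong_append[OF pres_cong_left_inv[of R u] pc_refl[of R "inv_word v"]] by simp
  moreover have "pres_cong R (inv_word u @ v @ inv_word v) (inv_word u @ u @ inv_word v)"
    using assms pres_cong_context pc_sym by blast
  moreover have "pres_cong R (inv_word u @ v @ inv_word v) (inv_word u)"
    using pres_cong_append[OF pc_refl[of R "inv_word u"] pres_cong_right_inv[of R v]] by simp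
  ultimately show ?thesis by (meson pc_sym pc_trans)
qed


section \<open>The Coxeter group and the braid group of type B2\<close>

datatype gen = S1 | S2

abbreviation pos :: "gen list \<Rightarrow> gen word" where
  "pos \<equiv> map (\<lambda>s. (s, True))"

definition coxeter_relations :: "(gen word \<times> gen word) set" where
  "coxeter_relations =
     {(pos [S1, S1], []), (pos [S2, S2], []), (pos [S1, S2, S1, S2, S1, S2, S1, S2], [])}"

definition braid_relations :: "(gen word \<times> gen word) set" where
  "braid_relations = {(pos [S1, S2, S1, S2], pos [S2, S1, S2, S1])}"

text \<open>
  Both groups are made instances of \<^class>\<open>group_add\<close>, which does not assume commutativity: the group
  law is written \<open>+\<close>, the neutral element \<open>0\<close>, and \<open>x - y\<close> means \<open>x y\<inverse>\<close>.
  This is what makes \<open>braid \<Rightarrow>\<^sub>0 complex\<close>, with its convolution product \<open>*\<close>, the group algebra.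
\<close>

quotient_type coxB2 = "gen word" / "pres_cong coxeter_relations"
  by (rule pres_cong_equivp)

quotient_type braid = "gen word" / "pres_cong braid_relations"
  by (rule pres_cong_equivp)

instantiation coxB2 :: group_add
begin
lift_definition zero_coxB2 :: coxB2 is "[]" .
lift_definition plus_coxB2 :: "coxB2 \<Rightarrow> coxB2 \<Rightarrow> coxB2" is "(@)"
  by (rule pres_cong_append)
lift_definition uminus_coxB2 :: "coxB2 \<Rightarrow> coxB2" is inv_word
  by (rule pres_cong_inv_word)
definition minus_coxB2 :: "coxB2 \<Rightarrow> coxB2 \<Rightarrow> coxB2" where
  "minus_coxB2 x y = x + - y"
instance
proof
  show "a + b + c = a + (b + c)" for a b c :: coxB2
    by transfer (simp add: pc_refl)
  show "0 + a = a" "a + 0 = a" for a :: coxB2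
    by (transfer, simp add: pc_refl)+
  show "- a + a = 0" for a :: coxB2
    by transfer (rule pres_cong_left_inv)
  show "a + - b = a - b" for a b :: coxB2
    by (simp add: minus_coxB2_def)
qed
end

instantiation braid :: group_add
begin
lift_definition zero_braid :: braid is "[]" .
lift_definition plus_braid :: "braid \<Rightarrow> braid \<Rightarrow> braid" is "(@)"
  by (rule pres_cong_append)
lift_definition uminus_braid :: "braid \<Rightarrow> braid" is inv_word
  by (rule pres_cong_inv_word)
definition minus_braid :: "braid \<Rightarrow> braid \<Rightarrow> braid" where
  "minus_braid x y = x + - y"
instance
proof
  show "a + b + c = a + (b + c)" for a b c :: braid
    by transfer (simp add: pc_refl)
  show "0 + a = a" "a + 0 = a" for a :: braid
    by (transfer, simp add: pc_refl)+
  show "- a + a = 0" for a :: braid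
    by transfer (rule pres_cong_left_inv)
  show "a + - b = a - b" for a b :: braid
    by (simp add: minus_braid_def)
qed
end

lift_definition wgen :: "gen \<Rightarrow> coxB2" is "\<lambda>s. [(s, True)]" .

lift_definition bgen :: "gen \<Rightarrow> braid" is "\<lambda>s. [(s, True)]" .

definition cox_length :: "coxB2 \<Rightarrow> nat" where
  "cox_length w = (LEAST n. \<exists>ss. length ss = n \<and> w = sum_list (map wgen ss))"

text \<open>Existence and uniqueness of the section are proved in \<open>is_section_tau\<close> and \<open>is_section_unique\<close>.\<close>

definition is_section :: "(coxB2 \<Rightarrow> braid) \<Rightarrow> bool" where
  "is_section t \<longleftrightarrow> (\<forall>s. t (wgen s) = bgen s) \<and>
     (\<forall>w w'. cox_length (w + w') = cox_length w + cox_length w' \<longrightarrow> t (w + w') = t w + t w')"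

definition tau :: "coxB2 \<Rightarrow> braid" where
  "tau = (THE t. is_section t)"


section \<open>Good representations of the braid group\<close>

definition braid_rep :: "(complex \<Rightarrow> 'v \<Rightarrow> 'v) \<Rightarrow> (braid \<Rightarrow> 'v \<Rightarrow> 'v::ab_group_add) \<Rightarrow> bool" where
  "braid_rep scale \<rho> \<longleftrightarrow>
     (\<forall>b. Vector_Spaces.linear scale scale (\<rho> b)) \<and> \<rho> 0 = id \<and> (\<forall>a b. \<rho> (a + b) = \<rho> a \<circ> \<rho> b)"

definition V_sub :: "(braid \<Rightarrow> 'v \<Rightarrow> 'v::ab_group_add) \<Rightarrow> gen \<Rightarrow> 'v set" where
  "V_sub \<rho> s = range (\<lambda>v. \<rho> (bgen s) (\<rho> (bgen s) v) - v)"

definition K_W :: "(braid \<Rightarrow> 'v \<Rightarrow> 'v::ab_group_add) \<Rightarrow> (coxB2 \<Rightarrow> 'v) set" where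
  "K_W \<rho> = {x. \<forall>s w. x (wgen s + w) - \<rho> (bgen s) (x w) \<in> V_sub \<rho> s}"

definition iota :: "(braid \<Rightarrow> 'v \<Rightarrow> 'v) \<Rightarrow> coxB2 \<Rightarrow> 'v \<Rightarrow> (coxB2 \<Rightarrow> 'v)" where
  "iota \<rho> y v = (\<lambda>w. \<rho> (tau (w - y)) v)"

text \<open>The span is taken in the space of all functions \<open>coxB2 \<Rightarrow> 'v\<close> with pointwise operations.\<close>

definition good :: "(complex \<Rightarrow> 'v \<Rightarrow> 'v) \<Rightarrow> (braid \<Rightarrow> 'v \<Rightarrow> 'v::ab_group_add) \<Rightarrow> bool" where
  "good scale \<rho> \<longleftrightarrow>
     K_W \<rho> = module.span (\<lambda>c x w. scale c (x w)) (\<Union>y. range (iota \<rho> y))"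


section \<open>The cubic Hecke algebra and its representations\<close>

definition braid_algebra :: "(braid \<Rightarrow>\<^sub>0 complex) ring" where
  "braid_algebra = \<lparr>carrier = UNIV, monoid.mult = (*), one = 1, zero = 0, add = (+)\<rparr>"

abbreviation in_alg :: "braid \<Rightarrow> (braid \<Rightarrow>\<^sub>0 complex)" where
  "in_alg b \<equiv> Poly_Mapping.single b 1"

abbreviation const_alg :: "complex \<Rightarrow> (braid \<Rightarrow>\<^sub>0 complex)" where
  "const_alg c \<equiv> Poly_Mapping.single 0 c"

definition cubic_ideal :: "complex \<Rightarrow> (braid \<Rightarrow>\<^sub>0 complex) set" where
  "cubic_ideal q = genideal braid_algebra
     (range (\<lambda>s. (in_alg (bgen s) - const_alg q) * (in_alg (bgen s) ^ 2 - 1)))"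

definition cubic_hecke :: "complex \<Rightarrow> (braid \<Rightarrow>\<^sub>0 complex) set ring" where
  "cubic_hecke q = braid_algebra Quot cubic_ideal q"

definition hecke_class :: "complex \<Rightarrow> (braid \<Rightarrow>\<^sub>0 complex) \<Rightarrow> (braid \<Rightarrow>\<^sub>0 complex) set" where
  "hecke_class q a = cubic_ideal q +>\<^bsub>braid_algebra\<^esub> a"

definition End_ring :: "(complex \<Rightarrow> 'v \<Rightarrow> 'v::ab_group_add) \<Rightarrow> ('v \<Rightarrow> 'v) ring" where
  "End_ring scale = \<lparr>carrier = {f. Vector_Spaces.linear scale scale f},
     monoid.mult = (\<circ>), one = id, zero = (\<lambda>_. 0), add = (\<lambda>f g v. f v + g v)\<rparr>"

text \<open>
  A representation is a unital homomorphism of complex algebras to the endomorphisms of the vector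
  space; the last conjunct is compatibility with the scalars.
\<close>

definition hecke_rep ::
  "(complex \<Rightarrow> 'v \<Rightarrow> 'v::ab_group_add) \<Rightarrow> complex \<Rightarrow> ((braid \<Rightarrow>\<^sub>0 complex) set \<Rightarrow> 'v \<Rightarrow> 'v) \<Rightarrow> bool"
  where
  "hecke_rep scale q \<phi> \<longleftrightarrow> vector_space scale \<and> \<phi> \<in> ring_hom (cubic_hecke q) (End_ring scale) \<and>
     (\<forall>c. \<phi> (hecke_class q (const_alg c)) = scale c)"

definition restrict_to_braid ::
  "complex \<Rightarrow> ((braid \<Rightarrow>\<^sub>0 complex) set \<Rightarrow> 'v \<Rightarrow> 'v) \<Rightarrow> braid \<Rightarrow> 'v \<Rightarrow> 'v" where
  "restrict_to_braid q \<phi> b = \<phi> (hecke_class q (in_alg b))"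


section \<open>Well-definedness\<close>

subsection \<open>The restriction is a representation of the braid group\<close>

lemma ring_braid_algebra: "ring braid_algebra"
proof (rule ringI)
  show "abelian_group braid_algebra"
    by (rule abelian_groupI)
      (auto simp: braid_algebra_def algebra_simps intro: exI[of _ "- _"] left_minus)
  show "Group.monoid braid_algebra"
    by (rule monoidI) (auto simp: braid_algebra_def mult.assoc)
qed (auto simp: braid_algebra_def algebra_simps)

lemma ideal_cubic_ideal: "ideal (cubic_ideal q) braid_algebra"
proof -
  interpret ring braid_algebra by (rule ring_braid_algebra)
  show ?thesis unfolding cubic_ideal_def
    by (rule genideal_ideal) (simp add: braid_algebra_def)
qed

lemma braid_rep_restrict:
  assumes "hecke_rep scale q \<phi>"
  shows "braid_rep scale (restrict_to_braid q \<phi>)"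
proof -
  interpret I: ideal "cubic_ideal q" braid_algebra by (rule ideal_cubic_ideal)
  have car: "hecke_class q a \<in> carrier (cubic_hecke q)" for a
    by (auto simp: cubic_hecke_def FactRing_def hecke_class_def braid_algebra_def
        A_RCOSETS_def RCOSETS_def a_r_coset_def)
  have mult: "hecke_class q a \<otimes>\<^bsub>cubic_hecke q\<^esub> hecke_class q b = hecke_class q (a * b)" for a b
    using I.rcoset_mult_add[of a b]
    by (simp add: cubic_hecke_def FactRing_def hecke_class_def braid_algebra_def)
  have one: "hecke_class q 1 = \<one>\<^bsub>cubic_hecke q\<^esub>"
    by (simp add: cubic_hecke_def FactRing_def hecke_class_def braid_algebra_def)
  have hom: "\<phi> \<in> ring_hom (cubic_hecke q) (End_ring scale)"
    using assms by (simp add: hecke_rep_def)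
  have "Vector_Spaces.linear scale scale (restrict_to_braid q \<phi> b)" for b
    using ring_hom_closed[OF hom car] by (simp add: restrict_to_braid_def End_ring_def)
  moreover have "restrict_to_braid q \<phi> 0 = id"
    using ring_hom_one[OF hom] one by (simp add: restrict_to_braid_def End_ring_def fun_eq_iff)
  moreover have "restrict_to_braid q \<phi> (a + b) = restrict_to_braid q \<phi> a \<circ> restrict_to_braid q \<phi> b"
    for a b
    using ring_hom_mult[OF hom car car, of "in_alg a" "in_alg b"] mult[of "in_alg a" "in_alg b"]
    by (simp add: restrict_to_braid_def End_ring_def mult_single fun_eq_iff)
  ultimately show ?thesis by (simp add: braid_rep_def)
qed


subsection \<open>The canonical section\<close>

text \<open>The reflection representation separates the elements of the Coxeter group.\<close>

fun reflection :: "gen \<times> bool \<Rightarrow> int \<times> int \<Rightarrow> int \<times> int" where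
  "reflection (S1, b) (x, y) = (y, x)"
| "reflection (S2, b) (x, y) = (x, - y)"

definition act_word :: "gen word \<Rightarrow> int \<times> int \<Rightarrow> int \<times> int" where
  "act_word u = foldr reflection u"

lemma act_word_cong: "pres_cong coxeter_relations u v \<Longrightarrow> act_word u = act_word v"
proof (induction rule: pres_cong.induct)
  case (pc_cancel u g b v)
  have "reflection (g, b) (reflection (g, \<not> b) p) = p" for p by (cases g; cases p) auto
  then show ?case by (auto simp: act_word_def)
next
  case (pc_rel l r u v)
  then have "act_word l p = act_word r p" for p
    by (cases p) (auto simp: act_word_def coxeter_relations_def)
  then show ?case by (auto simp: act_word_def)
qed auto

lift_definition act :: "coxB2 \<Rightarrow> int \<times> int \<Rightarrow> int \<times> int" is act_word
  by (rule act_word_cong)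

lemma act_0: "act 0 p = p"
  by transfer (simp add: act_word_def)

lemma act_plus: "act (a + b) p = act a (act b p)"
  by transfer (simp add: act_word_def)

lemma act_wgen: "act (wgen s) p = reflection (s, True) p"
  by transfer (simp add: act_word_def)

abbreviation wprod :: "gen list \<Rightarrow> coxB2" where
  "wprod ss \<equiv> sum_list (map wgen ss)"

abbreviation bprod :: "gen list \<Rightarrow> braid" where
  "bprod ss \<equiv> sum_list (map bgen ss)"

lemma wgen_square: "wgen s + wgen s = 0"
proof transfer
  fix s
  have "(pos [s, s], []) \<in> coxeter_relations"
    by (cases s) (auto simp: coxeter_relations_def)
  from pc_rel[OF this, of "[]" "[]"]
  show "pres_cong coxeter_relations ([(s, True)] @ [(s, True)]) []" by simp
qed

lemma wgen_square': "wgen s + (wgen s + w) = w"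
  by (simp add: wgen_square flip: add.assoc)

lemma wgen_order: "wprod [S1, S2, S1, S2, S1, S2, S1, S2] = 0"
proof -
  have "pres_cong coxeter_relations (pos [S1, S2, S1, S2, S1, S2, S1, S2]) []"
    using pc_rel[of "pos [S1, S2, S1, S2, S1, S2, S1, S2]" "[]" coxeter_relations "[]" "[]"]
    by (simp add: coxeter_relations_def)
  then show ?thesis by simp (transfer, simp)
qed

lemma wgen_uminus: "- wgen s = wgen s"
  using wgen_square[of s] by (simp add: minus_unique)

lemma wgen_braid:
  "wgen S2 + (wgen S1 + (wgen S2 + wgen S1)) = wgen S1 + (wgen S2 + (wgen S1 + wgen S2))"
proof -
  have "wprod [S1, S2, S1, S2] + wprod [S1, S2, S1, S2] = 0"
    using wgen_order by (simp add: add.assoc)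
  then have "- wprod [S1, S2, S1, S2] = wprod [S1, S2, S1, S2]"
    by (rule minus_unique)
  then show ?thesis by (simp add: minus_add wgen_uminus add.assoc)
qed

lemma bgen_braid:
  "bgen S2 + (bgen S1 + (bgen S2 + bgen S1)) = bgen S1 + (bgen S2 + (bgen S1 + bgen S2))"
proof -
  have "pres_cong braid_relations (pos [S2, S1, S2, S1]) (pos [S1, S2, S1, S2])"
    using pc_sym[OF pc_rel[of "pos [S1, S2, S1, S2]" "pos [S2, S1, S2, S1]" braid_relations "[]" "[]"]]
    by (simp add: braid_relations_def)
  then show ?thesis by transfer simp
qed

definition nfs :: "gen list list" where
  "nfs = [[], [S1], [S2], [S1, S2], [S2, S1], [S1, S2, S1], [S2, S1, S2], [S1, S2, S1, S2]]"

fun nf_pt :: "int \<times> int \<Rightarrow> gen list" where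
  "nf_pt p = (if p = (1, 2) then [] else if p = (2, 1) then [S1]
    else if p = (1, - 2) then [S2] else if p = (- 2, 1) then [S1, S2]
    else if p = (2, - 1) then [S2, S1] else if p = (- 1, 2) then [S1, S2, S1]
    else if p = (- 2, - 1) then [S2, S1, S2] else [S1, S2, S1, S2])"

definition nf :: "coxB2 \<Rightarrow> gen list" where
  "nf w = nf_pt (act w (1, 2))"

lemma nf_wprod: "ss \<in> set nfs \<Longrightarrow> nf (wprod ss) = ss"
  by (auto simp: nfs_def nf_def act_0 act_plus act_wgen)

definition lmul :: "gen \<Rightarrow> gen list \<Rightarrow> gen list" where
  "lmul s ss =
    (if s = S2 \<and> ss = [S1, S2, S1] then [S1, S2, S1, S2]
     else if s = S2 \<and> ss = [S1, S2, S1, S2] then [S1, S2, S1]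
     else if ss \<noteq> [] \<and> hd ss = s then tl ss else s # ss)"

lemma lmul:
  assumes "ss \<in> set nfs"
  shows "lmul s ss \<in> set nfs" "length (lmul s ss) \<le> Suc (length ss)"
    "wgen s + wprod ss = wprod (lmul s ss)"
proof -
  have long: "wgen S2 + (wgen S1 + (wgen S2 + (wgen S1 + wgen S2))) = wgen S1 + (wgen S2 + wgen S1)"
    by (metis wgen_braid wgen_square')
  show "lmul s ss \<in> set nfs" "length (lmul s ss) \<le> Suc (length ss)"
    using assms by (cases s; auto simp: lmul_def nfs_def)+
  show "wgen s + wprod ss = wprod (lmul s ss)"
    using assms by (cases s) (auto simp: lmul_def nfs_def wgen_square wgen_square' wgen_braid long)
qed

lemma foldr_lmul:
  assumes "ss \<in> set nfs"
  shows "foldr lmul as ss \<in> set nfs" "wprod as + wprod ss = wprod (foldr lmul as ss)"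
  by (induction as) (use assms lmul in \<open>auto simp: add.assoc\<close>)

lemma wprod_nfs: "\<exists>ss'\<in>set nfs. wprod ss = wprod ss' \<and> length ss' \<le> length ss"
proof (induction ss)
  case Nil
  show ?case by (auto simp: nfs_def)
next
  case (Cons s ss)
  then obtain ss' where *: "ss' \<in> set nfs" "wprod ss = wprod ss'" "length ss' \<le> length ss" by auto
  have "wprod (s # ss) = wprod (lmul s ss')" "length (lmul s ss') \<le> length (s # ss)"
    using lmul(2,3)[OF *(1), of s] *(2,3) by auto
  then show ?case using lmul(1)[OF *(1)] by blast
qed

lemma ex_wprod: "\<exists>ss. w = wprod ss"
proof -
  have "\<exists>ss. abs_coxB2 u = wprod ss" for u
  proof (induction u)
    case Nil
    show ?case by (rule exI[of _ "[]"]) (simp add: zero_coxB2_def)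
  next
    case (Cons a u)
    obtain g b where a: "a = (g, b)" by force
    have "abs_coxB2 [(g, False)] = - wgen g"
      by transfer (simp add: inv_word_def pc_refl)
    moreover have "abs_coxB2 [(g, True)] = wgen g"
      by (simp add: wgen_def)
    ultimately have "abs_coxB2 [a] = wgen g"
      by (cases b) (auto simp: a wgen_uminus)
    moreover have "abs_coxB2 (a # u) = abs_coxB2 [a] + abs_coxB2 u"
      by (simp add: plus_coxB2.abs_eq)
    moreover obtain ss where "abs_coxB2 u = wprod ss" using Cons by auto
    ultimately have "abs_coxB2 (a # u) = wprod (g # ss)" by simp
    then show ?case by blast
  qed
  then show ?thesis by (metis Quotient_abs_rep Quotient_coxB2)
qed

lemma nf_props: "nf w \<in> set nfs" "wprod (nf w) = w" "cox_length w = length (nf w)"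
proof -
  obtain ss where "w = wprod ss" using ex_wprod by blast
  then obtain ss' where *: "ss' \<in> set nfs" "w = wprod ss'" using wprod_nfs by metis
  then show 1: "nf w \<in> set nfs" "wprod (nf w) = w" by (auto simp: nf_wprod)
  show "cox_length w = length (nf w)" unfolding cox_length_def
  proof (rule Least_equality)
    show "\<exists>ss. length ss = length (nf w) \<and> w = wprod ss" using 1 by metis
    fix n assume "\<exists>ss. length ss = n \<and> w = wprod ss"
    then obtain ss where ss: "length ss = n" "w = wprod ss" by auto
    with wprod_nfs[of ss] nf_wprod show "length (nf w) \<le> n" by metis
  qed
qed

lemma is_section_nf: "is_section (\<lambda>w. bprod (nf w))"
  unfolding is_section_def
proof (intro conjI allI impI)
  show "bprod (nf (wgen s)) = bgen s" for s
    by (cases s) (auto simp: nf_def act_wgen)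
  fix w w' assume len: "cox_length (w + w') = cox_length w + cox_length w'"
  define a b where "a = nf w" and "b = nf w'"
  have ab: "a \<in> set nfs" "b \<in> set nfs" and w: "w = wprod a" "w' = wprod b"
    by (simp_all add: a_def b_def nf_props)
  have nf: "nf (w + w') = foldr lmul a b"
    by (simp add: w foldr_lmul nf_wprod ab)
  have "length (foldr lmul a b) = length a + length b"
    using len by (simp add: nf_props(3) nf a_def b_def)
  then have "bprod (foldr lmul a b) = bprod a + bprod b"
    using ab by (auto simp: nfs_def lmul_def bgen_braid add.assoc)
  then show "bprod (nf (w + w')) = bprod (nf w) + bprod (nf w')"
    by (simp add: nf flip: a_def b_def)
qed

lemma is_section_unique:
  assumes "is_section t"
  shows "t w = bprod (nf w)"
proof -
  have len: "cox_length (wprod ss) = length ss" if "ss \<in> set nfs" for ss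
    using that by (simp add: nf_props(3) nf_wprod)
  have "cox_length 0 = 0"
    using len[of "[]"] by (simp add: nfs_def)
  then have "t (0 + 0) = t 0 + t 0"
    using assms unfolding is_section_def by (metis add_0)
  then have 0: "t 0 = 0" by (metis add_0 add_left_cancel add.right_neutral)
  have step: "t (wprod (s # ss)) = bgen s + t (wprod ss)"
    if "s # ss \<in> set nfs" "ss \<in> set nfs" for s ss
  proof -
    have "[s] \<in> set nfs" by (cases s) (auto simp: nfs_def)
    then have "cox_length (wgen s) = 1" using len[of "[s]"] by simp
    then have "cox_length (wgen s + wprod ss) = cox_length (wgen s) + cox_length (wprod ss)"
      using len[OF that(1)] len[OF that(2)] by simp
    then show ?thesis using assms by (simp add: is_section_def)
  qed
  have tails: "ss \<in> set nfs" if "s # ss \<in> set nfs" for s ss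
    using that by (auto simp: nfs_def)
  have "ss \<in> set nfs \<Longrightarrow> t (wprod ss) = bprod ss" for ss
  proof (induction ss)
    case (Cons s ss)
    then show ?case using step[OF Cons.prems tails[OF Cons.prems]] tails by simp
  qed (simp add: 0)
  then show ?thesis using nf_props[of w] by metis
qed

lemma is_section_tau: "is_section tau"
  unfolding tau_def
  by (rule theI[of is_section, OF is_section_nf]) (auto simp: is_section_unique)

end

theory Submission
  imports Defs "HOL-Computational_Algebra.Polynomial"
begin

text \<open>
  Write \<open>s\<close>, \<open>t\<close> for the operators by which the two generators act on \<open>V\<close>.
  If \<open>q = 0\<close>, then \<open>s\<^sup>2 = t\<^sup>2 = 1\<close>, all \<open>V\<^sub>s\<close> vanish, and an element of \<open>K\<^sub>W(V)\<close> is determined by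
  its value at the neutral element. Otherwise \<open>q\<^sup>2 \<noteq> 1\<close>, so \<open>V\<^sub>s\<close> is the \<open>q\<close>-eigenspace of \<open>s\<close>, and
  \<open>stst = tsts\<close> is central and invertible; all vectors are treated as elements of a module over the
  polynomials in the central operator \<open>L = q\<^sup>-\<^sup>1 stst\<close>. On \<open>V\<^sub>s\<close> one has \<open>tst = L\<close>.

  The Cayley graph of \<open>W\<close> is an octagon whose edges are labelled \<open>s\<close> and \<open>t\<close> in turn, so an element of
  \<open>K\<^sub>W(V)\<close> is an octuple with one condition for each edge. Let \<open>G\<close> be the span of the translates
  \<open>i\<^sub>y(v)\<close>. For \<open>v\<close> in the eigenspace belonging to an edge, the difference of the two translates at its
  ends, weighted so that they cancel, is supported on the half of the octagon on one side of that edge.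
  With these elements every octuple is reduced modulo \<open>G\<close> to a residual one, supported on
  three consecutive corners with entries \<open>(a, b, c)\<close>. Two independent computations show that a residual
  octuple \<open>x\<close> lies in \<open>G\<close>.

  First, \<open>(1 - L\<^sup>2) x \<in> G\<close>: a half-octagon starting with \<open>a\<close>, and one running back
  from its far end, remove \<open>a\<close> (\<open>one_minus_LL_kills_residual\<close>), and the remaining octuples \<open>(0, b, c)\<close> are sums of ones of the
  form \<open>(0, e, \<plusminus>e)\<close>, where \<open>e\<close> and \<open>s e\<close> span a submodule on which everything is explicit
  (\<open>eigen_pair_in_G\<close>).

  Second, \<open>r(L) x \<in> G\<close> for a polynomial \<open>r\<close> that does not vanish at \<open>1\<close> and \<open>-1\<close> (\<open>residual_killed\<close>).
  The reason is a relation in the cubic Hecke algebra: up to a polynomial in \<open>L\<close>,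
  \<open>(t\<^sup>2 - 1)\<close> maps \<open>V\<^sub>s\<close> into \<open>V\<^sub>s \<inter> V\<^sub>t\<close> (\<open>exchange_relation\<close>). On \<open>V\<^sub>s \<inter> V\<^sub>t\<close> both generators act as
  \<open>q\<close>, and there the claim is that the matrix with entries \<open>q\<^bsup>l(wy\<^sup>-\<^sup>1)\<^esup>\<close> is invertible,
  whose determinant is a product of factors \<open>1 - q\<^sup>2\<close> and \<open>1 - q\<^sup>8\<close>.
  After subtracting such octuples one may assume \<open>t\<^sup>2 a = a\<close> and \<open>s\<^sup>2 c = c\<close>. The braid relation then
  makes \<open>s\<close> act on \<open>t a\<close>, and \<open>t\<close> on \<open>s c\<close>, as \<open>L\<close>; further factors of \<open>r\<close> give \<open>t a = s c\<close>, and on this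
  vector \<open>q L = stst = L\<^sup>4 = 1\<close>.

  Since \<open>r\<close> and \<open>1 - L\<^sup>2\<close> have no common root, \<open>x \<in> G\<close>.
\<close>

section \<open>Operators satisfying the braid relation and the cubic relation\<close>

text \<open>
  The scalars are the polynomials in the central operator \<open>L\<close>, so that all identities between vectors
  become identities between coefficients in a commutative ring. \<open>Q\<close> and \<open>L\<close> are names for the
  constant \<open>q\<close> and the indeterminate; they keep the simplifier from unfolding polynomials into lists
  of coefficients.
\<close>

locale B2_cubic = module smul
  for smul :: "complex poly \<Rightarrow> 'v::ab_group_add \<Rightarrow> 'v"  (infixr \<open>\<cdot>\<close> 75) +
  fixes q :: complex and Q L :: "complex poly" and s t :: "'v \<Rightarrow> 'v"
  assumes Q_eq: "Q = [:q:]" and L_eq: "L = [:0, 1:]"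
    and q_nonzero: "q \<noteq> 0" and q_power8: "q ^ 8 \<noteq> 1"
    and s_add: "s (u + v) = s u + s v" and s_smul: "s (p \<cdot> v) = p \<cdot> s v"
    and t_add: "t (u + v) = t u + t v" and t_smul: "t (p \<cdot> v) = p \<cdot> t v"
    and s_cubic: "s (s (s v)) = Q \<cdot> s (s v) + s v - Q \<cdot> v"
    and t_cubic: "t (t (t v)) = Q \<cdot> t (t v) + t v - Q \<cdot> v"
    and stst: "s (t (s (t v))) = (Q * L) \<cdot> v"
    and tsts: "t (s (t (s v))) = (Q * L) \<cdot> v"
begin

text \<open>
  The relations are symmetric in \<open>s\<close> and \<open>t\<close>; facts proved for \<open>s\<close> become available for \<open>t\<close> under the
  prefix \<open>swap\<close>.
\<close>

sublocale swap: B2_cubic smul q Q L t s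
  by unfold_locales (simp_all add: Q_eq L_eq q_nonzero q_power8 s_add s_smul t_add t_smul s_cubic t_cubic
     stst[unfolded Q_eq L_eq] tsts[unfolded Q_eq L_eq])

end

context B2_cubic begin

lemma s_diff: "s (u - v) = s u - s v"
  by (metis s_add diff_add_cancel add_diff_cancel)

lemma s_zero: "s 0 = 0"
  using s_diff[of 0 0] by simp

lemma s_minus: "s (- v) = - s v"
  using s_diff[of 0 v] by (simp add: s_zero)

end

context B2_cubic begin

lemmas lin = s_add t_add s_diff swap.s_diff s_smul t_smul s_zero swap.s_zero

lemma Q_cancel:
  assumes "Q \<cdot> u = Q \<cdot> v" shows "u = v"
proof -
  have "[:inverse q:] * Q = 1" using q_nonzero by (simp add: Q_eq one_pCons)
  moreover have "[:inverse q:] \<cdot> (Q \<cdot> u) = [:inverse q:] \<cdot> (Q \<cdot> v)" using assms by metis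
  ultimately show ?thesis by (metis scale_scale scale_one)
qed

lemma s_inj:
  assumes "s u = s v" shows "u = v"
proof -
  have "Q \<cdot> u = Q \<cdot> s (s u) + s u - s (s (s u))" by (simp add: s_cubic)
  also have "\<dots> = Q \<cdot> v" by (simp add: assms s_cubic)
  finally show ?thesis by (rule Q_cancel)
qed

lemma s_surj: "\<exists>u. s u = v"
proof -
  have *: "[:inverse q:] * Q = 1" using q_nonzero by (simp add: Q_eq one_pCons)
  have "s ([:inverse q:] \<cdot> (v + Q \<cdot> s v - s (s v))) = [:inverse q:] \<cdot> (Q \<cdot> v)"
    unfolding s_smul by (rule arg_cong[where f="smul _"]) (simp add: lin s_cubic)
  then show ?thesis using * by (metis scale_scale scale_one)
qed

definition eig :: "('v \<Rightarrow> 'v) \<Rightarrow> 'v set" where "eig f = {v. f v = Q \<cdot> v}"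

lemma eig_iff: "v \<in> eig f \<longleftrightarrow> f v = Q \<cdot> v"
  by (simp add: eig_def)

lemma subspace_eig: "subspace (eig s)"
  by (auto simp: subspace_def eig_iff lin algebra_simps)

lemma square_in_eig: "s (s v) - v \<in> eig s"
  by (simp add: eig_iff lin s_cubic algebra_simps)

lemma square_in_eig': "v - s (s v) \<in> eig s"
  by (simp add: eig_iff lin s_cubic algebra_simps)

text \<open>On the eigenspace of \<open>s\<close>, the central element \<open>tsts\<close> is \<open>q tst\<close>.\<close>

lemma tst_on_eig:
  assumes "v \<in> eig s" shows "t (s (t v)) = L \<cdot> v"
proof (rule Q_cancel)
  have "Q \<cdot> t (s (t v)) = t (s (t (s v)))" using assms by (simp add: eig_iff lin)
  then show "Q \<cdot> t (s (t v)) = Q \<cdot> L \<cdot> v" by (simp add: tsts)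
qed

lemma tst_on_eig_s: "s v = Q \<cdot> v \<Longrightarrow> t (s (t v)) = L \<cdot> v"
  using tst_on_eig by (simp add: eig_iff)

lemma q_square: "q * q \<noteq> 1"
proof
  assume "q * q = 1"
  then have "q ^ 8 = 1" by (simp add: power_numeral_even)
  then show False using q_power8 by simp
qed

lemma q_nonroots: "1 + q * q \<noteq> 0" "1 + q * q * q * q \<noteq> 0"
proof -
  have "q ^ 8 - 1 = (1 + q * q) * ((q * q - 1) * (1 + q * q * q * q))"
    by (simp add: eval_nat_numeral algebra_simps)
  with q_power8 show "1 + q * q \<noteq> 0" "1 + q * q * q * q \<noteq> 0" by force+
qed

lemma one_minus_QQ_unit: "(1 - Q * Q) dvd 1"
proof -
  have "1 - Q * Q = [:1 - q * q:]" by (simp add: Q_eq one_pCons)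
  then show ?thesis using q_square by (simp add: is_unit_const_poly_iff dvd_field_iff)
qed

end

context B2_cubic begin

lemma eig_square: "v \<in> eig s \<Longrightarrow> s (s v) - v = (Q * Q - 1) \<cdot> v"
  by (simp add: eig_iff s_smul scale_left_diff_distrib)

lemma QQ_minus_one_cancel:
  assumes "(Q * Q - 1) \<cdot> u = (Q * Q - 1) \<cdot> v" shows "u = v"
proof -
  obtain p where "1 = (1 - Q * Q) * p" using one_minus_QQ_unit by (rule dvdE)
  then have p: "(- p) * (Q * Q - 1) = 1" by (simp add: algebra_simps)
  from assms have "(- p) \<cdot> (Q * Q - 1) \<cdot> u = (- p) \<cdot> (Q * Q - 1) \<cdot> v" by (rule arg_cong)
  then show ?thesis unfolding scale_scale p by simp
qed

section \<open>The exchange relation between the two eigenspaces\<close>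

text \<open>
  For generic \<open>q\<close>, the roots of this polynomial other than \<open>0\<close> are the values of \<open>L\<close> on the irreducible
  representations of the cubic Hecke algebra of dimension two (\<open>L\<^sup>2 = q\<^sup>2\<close>) and three (\<open>L\<^sup>3 = q\<close>) in
  which both generators have the eigenvalue \<open>q\<close>. The factor \<open>L\<close> clears a denominator.
\<close>

definition exchange :: "complex poly" where
  "exchange = L * ((L * L - Q * Q) * (L * L * L - Q))"

text \<open>
  Start with \<open>a\<close> in the eigenspace of \<open>s\<close>. The submodule it generates is spanned by the four vectors
  \<open>a\<close>, \<open>f = t a\<close>, \<open>g = t\<^sup>-\<^sup>1 a\<close> and \<open>h = s\<^sup>-\<^sup>1 f\<close>: the braid relation expresses \<open>s f\<close> and \<open>t h\<close> through them.
  The only condition not yet used is the cubic relation for \<open>t\<close> at \<open>h\<close>. Modulo the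
  \<open>q\<close>-eigenvectors \<open>a\<close> and \<open>s\<^sup>2 h - h\<close> of \<open>s\<close>, it says that a multiple of \<open>L h - f\<close> vanishes, and \<open>s\<close> maps
  \<open>L h - f\<close> to \<open>L (f - g)\<close>, where \<open>q (f - g) = t\<^sup>2 a - a\<close>.
\<close>

lemma exchange_relation:
  assumes "a \<in> eig s"
  shows "exchange \<cdot> (t (t a) - a) \<in> eig s"
proof -
  define f where "f = t a"
  obtain g where g: "t g = a" using swap.s_surj by blast
  obtain h where h: "s h = f" using s_surj by blast
  have tf: "t f = Q \<cdot> f + a - Q \<cdot> g"
    using t_cubic[of g] by (simp add: f_def g)
  have sf: "s f = L \<cdot> g"
    by (rule swap.s_inj) (use tst_on_eig[OF assms] in \<open>simp add: f_def lin g\<close>)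
  define k where "k = f - g"
  have k: "k \<in> eig t" by (simp add: eig_iff k_def lin tf g algebra_simps)
  have stk: "s (t (s k)) = L \<cdot> k"
    using swap.tst_on_eig[of k] k by (simp add: eig_iff)
  have tsk: "t (s k) = L \<cdot> h - f"
    by (rule s_inj, subst stk) (simp add: lin h sf k_def algebra_simps)
  have Lsg: "L \<cdot> s g = (Q * L) \<cdot> g + f - Q \<cdot> h"
    using s_cubic[of h] by (simp add: h sf lin)
  \<comment> \<open>Both \<open>t (s k)\<close> and \<open>L \<cdot> s k\<close> are known; applying \<open>t\<close> to the latter and comparing gives \<open>t h\<close>.\<close>
  have "L \<cdot> s k = (L * L) \<cdot> g - L \<cdot> s g"
    by (simp add: k_def lin sf algebra_simps)
  then have "t (L \<cdot> s k) = t ((L * L) \<cdot> g - ((Q * L) \<cdot> g + f - Q \<cdot> h))"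
    by (simp only: Lsg)
  then have th: "Q \<cdot> t h = (1 + Q * L - L * L) \<cdot> a + (Q - L) \<cdot> f - Q \<cdot> g + (L * L) \<cdot> h"
    by (simp add: lin tsk g tf algebra_simps)
  \<comment> \<open>From here on, vectors are coefficient quadruples.\<close>
  define c where "c \<alpha> \<beta> \<gamma> \<eta> = \<alpha> \<cdot> a + \<beta> \<cdot> f + \<gamma> \<cdot> g + \<eta> \<cdot> h" for \<alpha> \<beta> \<gamma> \<eta>
  have Qt: "Q \<cdot> t (c \<alpha> \<beta> \<gamma> \<eta>) = c (\<eta> * (1 + Q * L - L * L) + Q * \<beta> + Q * \<gamma>)
      (Q * \<alpha> + Q * Q * \<beta> + \<eta> * (Q - L)) (- Q * Q * \<beta> - Q * \<eta>) (\<eta> * L * L)" for \<alpha> \<beta> \<gamma> \<eta>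
  proof -
    have "Q \<cdot> t (c \<alpha> \<beta> \<gamma> \<eta>) = Q \<cdot> (\<alpha> \<cdot> f + \<beta> \<cdot> t f + \<gamma> \<cdot> a) + \<eta> \<cdot> Q \<cdot> t h"
      by (simp add: c_def lin g f_def algebra_simps)
    then show ?thesis by (simp add: th tf c_def algebra_simps)
  qed
  have c_add: "c \<alpha> \<beta> \<gamma> \<eta> + c \<alpha>' \<beta>' \<gamma>' \<eta>' = c (\<alpha> + \<alpha>') (\<beta> + \<beta>') (\<gamma> + \<gamma>') (\<eta> + \<eta>')"
    and c_diff: "c \<alpha> \<beta> \<gamma> \<eta> - c \<alpha>' \<beta>' \<gamma>' \<eta>' = c (\<alpha> - \<alpha>') (\<beta> - \<beta>') (\<gamma> - \<gamma>') (\<eta> - \<eta>')"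
    and c_smul: "p \<cdot> c \<alpha> \<beta> \<gamma> \<eta> = c (p * \<alpha>) (p * \<beta>) (p * \<gamma>) (p * \<eta>)"
    for p \<alpha> \<beta> \<gamma> \<eta> \<alpha>' \<beta>' \<gamma>' \<eta>'
    by (simp_all add: c_def algebra_simps)
  have c_cong: "c \<alpha> \<beta> \<gamma> \<eta> = c \<alpha>' \<beta>' \<gamma>' \<eta>'"
    if "\<alpha> = \<alpha>'" "\<beta> = \<beta>'" "\<gamma> = \<gamma>'" "\<eta> = \<eta>'"
    for \<alpha> \<beta> \<gamma> \<eta> \<alpha>' \<beta>' \<gamma>' \<eta>' using that by simp
  have hc: "h = c 0 0 0 1" by (simp add: c_def)
  define M where "M = (L * L - Q * Q) * (L * L * L - Q)"
  define \<gamma> where "\<gamma> = Q * (L * L - Q * Q) * (Q - L)"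
  define \<alpha> where "\<alpha> = - (L * L - Q * Q) * L * (L - Q) * (L * L - 1)"
  have "0 = Q \<cdot> t (Q \<cdot> t (Q \<cdot> t h)) -
      ((Q * Q) \<cdot> (Q \<cdot> t (Q \<cdot> t h)) + (Q * Q) \<cdot> (Q \<cdot> t h) - (Q * Q * Q * Q) \<cdot> h)"
    using arg_cong[OF t_cubic[of h], of "smul (Q * Q * Q)"] by (simp add: lin algebra_simps)
  also have "\<dots> = c \<alpha> (- M) (\<gamma> * L) (M * L - \<gamma>)"
    unfolding hc Qt c_add c_diff c_smul \<alpha>_def \<gamma>_def M_def
    by (rule c_cong) (simp_all add: algebra_simps)
  finally have "0 = c \<alpha> (- M) (\<gamma> * L) (M * L - \<gamma>)" .
  then have "M \<cdot> (L \<cdot> h - f) = - \<alpha> \<cdot> a - \<gamma> \<cdot> (s (s h) - h)"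
    by (simp add: c_def h sf algebra_simps eq_neg_iff_add_eq_0)
  then have "M \<cdot> (L \<cdot> h - f) \<in> eig s"
    using assms square_in_eig[of h] by (simp add: subspace_eig subspace_diff subspace_neg subspace_scale)
  moreover have "(L * M) \<cdot> (t (t a) - a) = s (Q \<cdot> M \<cdot> (L \<cdot> h - f))"
    by (simp add: lin h sf tf f_def[symmetric] k_def algebra_simps)
  moreover have "s (Q \<cdot> w) \<in> eig s" if "w \<in> eig s" for w
    using that by (simp add: eig_iff lin ac_simps)
  ultimately show ?thesis unfolding M_def exchange_def by metis
qed

end

context B2_cubic begin

lemma exchange_common_eig:
  assumes "a \<in> eig s"
  shows "exchange \<cdot> (t (t a) - a) \<in> eig s" "exchange \<cdot> (t (t a) - a) \<in> eig t"
  using exchange_relation[OF assms] subspace_scale[OF swap.subspace_eig swap.square_in_eig]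
  by simp_all

text \<open>
  The vectors of the eigenspace of \<open>s\<close> that \<open>t\<^sup>2\<close> fixes are the ones on which the exchange relation is
  empty: their \<open>q\<close>-eigencomponent for \<open>t\<close> is zero. For them \<open>s\<close> acts on \<open>t a\<close> as the scalar \<open>L\<close>, so the \<open>q\<close>-eigencomponent of \<open>t a\<close> lives at \<open>L = q\<close>.
\<close>

lemma square_fixed_eigenvector:
  assumes a: "a \<in> eig s" and tta: "t (t a) = a"
  shows "s (t a) = L \<cdot> t a" "(L - Q) \<cdot> (s (s (t a)) - t a) = 0"
proof -
  show st: "s (t a) = L \<cdot> t a"
    by (rule swap.s_inj) (simp add: t_smul tta tst_on_eig[OF a])
  have "s (s (s (t a)) - t a) = Q \<cdot> (s (s (t a)) - t a)"
    using square_in_eig[of "t a"] by (simp add: eig_iff)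
  then show "(L - Q) \<cdot> (s (s (t a)) - t a) = 0"
    by (simp add: st s_smul s_diff algebra_simps)
qed

section \<open>Octuples\<close>

text \<open>
  The octuples of values of \<open>i\<^sub>y(v)\<close> at the corners \<open>1\<close>, \<open>s\<close>, \<open>ts\<close>, \<open>sts\<close>, \<open>w\<^sub>0\<close>, \<open>tst\<close>, \<open>st\<close>, \<open>t\<close> of the octagon, for
  \<open>y\<close> running through the same corners.
\<close>

definition translates :: "'v \<Rightarrow> 'v list set" where
  "translates v =
    {[v, s v, t (s v), s (t (s v)), (Q * L) \<cdot> v, t (s (t v)), s (t v), t v],
     [s v, v, t v, s (t v), t (s (t v)), (Q * L) \<cdot> v, s (t (s v)), t (s v)],
     [s (t v), t v, v, s v, t (s v), s (t (s v)), (Q * L) \<cdot> v, t (s (t v))],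
     [s (t (s v)), t (s v), s v, v, t v, s (t v), t (s (t v)), (Q * L) \<cdot> v],
     [(Q * L) \<cdot> v, t (s (t v)), s (t v), t v, v, s v, t (s v), s (t (s v))],
     [t (s (t v)), (Q * L) \<cdot> v, s (t (s v)), t (s v), s v, v, t v, s (t v)],
     [t (s v), s (t (s v)), (Q * L) \<cdot> v, t (s (t v)), s (t v), t v, v, s v],
     [t v, s (t v), t (s (t v)), (Q * L) \<cdot> v, s (t (s v)), t (s v), s v, v]}"

inductive_set G :: "'v list set" where
  translate: "x \<in> translates v \<Longrightarrow> x \<in> G"
| add: "x \<in> G \<Longrightarrow> y \<in> G \<Longrightarrow> map2 (+) x y \<in> G"
| smul: "x \<in> G \<Longrightarrow> map (smul p) x \<in> G"

text \<open>
  One condition for each edge is enough: the condition for the opposite orientation of an edge differs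
  from it by an element of the image of \<open>s\<^sup>2 - 1\<close>.
\<close>

definition K :: "'v list set" where
  "K = {[x0, x1, x2, x3, x4, x5, x6, x7] | x0 x1 x2 x3 x4 x5 x6 x7.
     x1 - s x0 \<in> eig s \<and> x2 - t x1 \<in> eig t \<and> x3 - s x2 \<in> eig s \<and> x4 - t x3 \<in> eig t \<and>
     x5 - s x4 \<in> eig s \<and> x6 - t x5 \<in> eig t \<and> x7 - s x6 \<in> eig s \<and> x0 - t x7 \<in> eig t}"

lemma K_iff:
    "[x0, x1, x2, x3, x4, x5, x6, x7] \<in> K \<longleftrightarrow>
     x1 - s x0 \<in> eig s \<and> x2 - t x1 \<in> eig t \<and> x3 - s x2 \<in> eig s \<and> x4 - t x3 \<in> eig t \<and>
     x5 - s x4 \<in> eig s \<and> x6 - t x5 \<in> eig t \<and> x7 - s x6 \<in> eig s \<and> x0 - t x7 \<in> eig t"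
  by (simp add: K_def)

lemma zero_in_eig: "0 \<in> eig s"
  by (simp add: eig_iff lin)

lemma braid_step: "t (s (t v)) - (Q * L) \<cdot> s v \<in> eig s"
  using square_in_eig'[of "t (s (t v))"] by (simp add: stst lin)

end

context B2_cubic begin

lemma translates_subset_K: "translates v \<subseteq> K"
  unfolding translates_def
  by (simp add: K_iff zero_in_eig swap.zero_in_eig square_in_eig' swap.square_in_eig' stst tsts lin
      braid_step swap.braid_step)

lemma G_diff:
  assumes "x \<in> G" "y \<in> G" shows "map2 (-) x y \<in> G"
proof -
  have "map2 (+) x (map (smul (- 1)) y) \<in> G" using assms by (intro G.add G.smul)
  also have "map2 (+) x (map (smul (- 1)) y) = map2 (-) x y"
    by (simp add: zip_map2 case_prod_beta)
  finally show ?thesis .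
qed

lemma G_subset_K: "x \<in> G \<Longrightarrow> x \<in> K"
proof (induction rule: G.induct)
  case (translate x v) then show ?case using translates_subset_K by blast
next
  case (add x y)
  have *: "(a + a') - s (b + b') = (a - s b) + (a' - s b')"
     "(a + a') - t (b + b') = (a - t b) + (a' - t b')" for a a' b b' by (simp_all add: lin)
  from add show ?case
    unfolding K_def by (auto simp: * intro!: subspace_add subspace_eig swap.subspace_eig)
next
  case (smul x p)
  have *: "p \<cdot> a - s (p \<cdot> b) = p \<cdot> (a - s b)" "p \<cdot> a - t (p \<cdot> b) = p \<cdot> (a - t b)" for a b
    by (simp_all add: lin algebra_simps)
  from smul show ?case
    unfolding K_def by (auto simp: * intro!: subspace_scale subspace_eig swap.subspace_eig)
qed

lemma K_diff:
  assumes "[x0, x1, x2, x3, x4, x5, x6, x7] \<in> K" "[y0, y1, y2, y3, y4, y5, y6, y7] \<in> G"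
  shows "[x0 - y0, x1 - y1, x2 - y2, x3 - y3, x4 - y4, x5 - y5, x6 - y6, x7 - y7] \<in> K"
proof -
  have *: "(a - a') - s (b - b') = (a - s b) - (a' - s b')"
     "(a - a') - t (b - b') = (a - t b) - (a' - t b')" for a a' b b' by (simp_all add: lin)
  from assms(1) G_subset_K[OF assms(2)] show ?thesis
    unfolding K_iff * by (simp add: subspace_diff subspace_eig swap.subspace_eig)
qed

lemma G_unit:
  assumes "map (smul p) x \<in> G" "p dvd 1"
  shows "x \<in> G"
proof -
  obtain u where u: "1 = p * u" using assms(2) by (rule dvdE)
  have "map (smul u) (map (smul p) x) \<in> G" using assms(1) by (rule G.smul)
  then show ?thesis by (simp add: o_def mult.commute[of u] flip: u)
qed

text \<open>
  Modulo \<open>G\<close>, an octuple killed by \<open>(L - c) p\<close> becomes, after multiplication by \<open>p\<close>, an octuple on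
  which \<open>L\<close> is the scalar \<open>c\<close>, so that \<open>r\<close> acts on it as the unit \<open>r(c)\<close>. Applied root after root, this
  takes the place of Bezout coefficients for polynomials that depend on \<open>q\<close>.
\<close>

lemma G_cancel_root:
  assumes "map (smul ((L - [:c:]) * p)) x \<in> G" "map (smul r) x \<in> G" "poly r c \<noteq> 0"
  shows "map (smul p) x \<in> G"
proof (rule G_unit)
  show "[:poly r c:] dvd 1" using assms(3) by (simp add: is_unit_const_poly_iff dvd_field_iff)
  have "poly (r - [:poly r c:]) c = 0" by simp
  then obtain r' where r': "r - [:poly r c:] = (L - [:c:]) * r'"
    unfolding poly_eq_0_iff_dvd dvd_def by (auto simp: L_eq)
  have eq: "[:poly r c:] * p = p * r - r' * ((L - [:c:]) * p)"
  proof -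
    have r: "r = [:poly r c:] + (L - [:c:]) * r'" using r' by (simp only: diff_eq_eq add.commute)
    show ?thesis by (subst (2) r) (simp add: algebra_simps)
  qed
  have "map2 (-) (map (smul p) (map (smul r) x)) (map (smul r') (map (smul ((L - [:c:]) * p)) x)) \<in> G"
    (is "?y \<in> G")
    by (intro G_diff G.smul[OF assms(1)] G.smul[OF assms(2)])
  also have "?y = map (\<lambda>a. p \<cdot> r \<cdot> a - r' \<cdot> ((L - [:c:]) * p) \<cdot> a) x"
    by (induction x) (simp_all only: list.map zip_Cons_Cons zip_Nil prod.case)
  also have "\<dots> = map (smul [:poly r c:]) (map (smul p) x)"
    by (simp only: map_map o_def scale_scale eq scale_left_diff_distrib)
  finally show "map (smul [:poly r c:]) (map (smul p) x) \<in> G" .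
qed

section \<open>Octuples supported on half of the octagon\<close>

text \<open>
  For \<open>v\<close> in the eigenspace of the label of an edge with ends \<open>y\<close> and \<open>z\<close>, the octuples \<open>i\<^sub>y(v)\<close> and
  \<open>q i\<^sub>z(v)\<close> agree on the side of \<open>z\<close>, and on the side of \<open>y\<close> the second is \<open>q\<^sup>2\<close> times the first.
  The names say at which corner the support starts and in which direction it runs.
\<close>

lemma half_up_1:
  assumes "v \<in> eig s" shows "[0, v, t v, s (t v), L \<cdot> v, 0, 0, 0] \<in> G"
proof (rule G_unit[OF _ one_minus_QQ_unit])
  have "map2 (-) [s v, v, t v, s (t v), t (s (t v)), (Q * L) \<cdot> v, s (t (s v)), t (s v)]
    (map (smul Q) [v, s v, t (s v), s (t (s v)), (Q * L) \<cdot> v, t (s (t v)), s (t v), t v]) \<in> G"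
    by (intro G_diff G.smul G.translate[of _ v]) (simp_all add: translates_def)
  then show "map (smul (1 - Q * Q)) [0, v, t v, s (t v), L \<cdot> v, 0, 0, 0] \<in> G"
    using assms by (simp add: eig_iff lin tst_on_eig_s algebra_simps)
qed

lemma half_up_2:
  assumes "v \<in> eig t" shows "[0, 0, v, s v, t (s v), L \<cdot> v, 0, 0] \<in> G"
proof (rule G_unit[OF _ one_minus_QQ_unit])
  have "map2 (-) [s (t v), t v, v, s v, t (s v), s (t (s v)), (Q * L) \<cdot> v, t (s (t v))]
    (map (smul Q) [s v, v, t v, s (t v), t (s (t v)), (Q * L) \<cdot> v, s (t (s v)), t (s v)]) \<in> G"
    by (intro G_diff G.smul G.translate[of _ v]) (simp_all add: translates_def)
  then show "map (smul (1 - Q * Q)) [0, 0, v, s v, t (s v), L \<cdot> v, 0, 0] \<in> G"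
    using assms by (simp add: eig_iff lin swap.tst_on_eig_s algebra_simps)
qed

lemma half_up_3:
  assumes "v \<in> eig s" shows "[0, 0, 0, v, t v, s (t v), L \<cdot> v, 0] \<in> G"
proof (rule G_unit[OF _ one_minus_QQ_unit])
  have "map2 (-) [s (t (s v)), t (s v), s v, v, t v, s (t v), t (s (t v)), (Q * L) \<cdot> v]
    (map (smul Q) [s (t v), t v, v, s v, t (s v), s (t (s v)), (Q * L) \<cdot> v, t (s (t v))]) \<in> G"
    by (intro G_diff G.smul G.translate[of _ v]) (simp_all add: translates_def)
  then show "map (smul (1 - Q * Q)) [0, 0, 0, v, t v, s (t v), L \<cdot> v, 0] \<in> G"
    using assms by (simp add: eig_iff lin tst_on_eig_s algebra_simps)
qed

lemma half_up_4:
  assumes "v \<in> eig t" shows "[0, 0, 0, 0, v, s v, t (s v), L \<cdot> v] \<in> G"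
proof (rule G_unit[OF _ one_minus_QQ_unit])
  have "map2 (-) [(Q * L) \<cdot> v, t (s (t v)), s (t v), t v, v, s v, t (s v), s (t (s v))]
    (map (smul Q) [s (t (s v)), t (s v), s v, v, t v, s (t v), t (s (t v)), (Q * L) \<cdot> v]) \<in> G"
    by (intro G_diff G.smul G.translate[of _ v]) (simp_all add: translates_def)
  then show "map (smul (1 - Q * Q)) [0, 0, 0, 0, v, s v, t (s v), L \<cdot> v] \<in> G"
    using assms by (simp add: eig_iff lin swap.tst_on_eig_s algebra_simps)
qed

lemma half_down_7:
  assumes "v \<in> eig t" shows "[0, 0, 0, 0, L \<cdot> v, t (s v), s v, v] \<in> G"
proof (rule G_unit[OF _ one_minus_QQ_unit])
  have "map2 (-) [t v, s (t v), t (s (t v)), (Q * L) \<cdot> v, s (t (s v)), t (s v), s v, v]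
    (map (smul Q) [v, s v, t (s v), s (t (s v)), (Q * L) \<cdot> v, t (s (t v)), s (t v), t v]) \<in> G"
    by (intro G_diff G.smul G.translate[of _ v]) (simp_all add: translates_def)
  then show "map (smul (1 - Q * Q)) [0, 0, 0, 0, L \<cdot> v, t (s v), s v, v] \<in> G"
    using assms by (simp add: eig_iff lin swap.tst_on_eig_s algebra_simps)
qed

lemma half_down_6:
  assumes "v \<in> eig s" shows "[0, 0, 0, L \<cdot> v, s (t v), t v, v, 0] \<in> G"
proof (rule G_unit[OF _ one_minus_QQ_unit])
  have "map2 (-) [t (s v), s (t (s v)), (Q * L) \<cdot> v, t (s (t v)), s (t v), t v, v, s v]
    (map (smul Q) [t v, s (t v), t (s (t v)), (Q * L) \<cdot> v, s (t (s v)), t (s v), s v, v]) \<in> G"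
    by (intro G_diff G.smul G.translate[of _ v]) (simp_all add: translates_def)
  then show "map (smul (1 - Q * Q)) [0, 0, 0, L \<cdot> v, s (t v), t v, v, 0] \<in> G"
    using assms by (simp add: eig_iff lin tst_on_eig_s algebra_simps)
qed

section \<open>Octuples with one entry on which both generators act as a scalar\<close>

text \<open>
  If both generators act on \<open>u\<close> as \<open>q\<close>, the translates of \<open>u\<close> are the rows of the matrix with entries
  \<open>q\<^sup>d u\<close>, where \<open>d\<close> is the distance in the octagon.
\<close>

definition powers :: "'v \<Rightarrow> nat list \<Rightarrow> 'v list" where
  "powers u = map (\<lambda>n. Q ^ n \<cdot> u)"

lemma powers_in_G:
  assumes "u \<in> eig s" "u \<in> eig t"
  shows "powers u [0, 1, 2, 3, 4, 3, 2, 1] \<in> G"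
    "powers u [1, 0, 1, 2, 3, 4, 3, 2] \<in> G"
    "powers u [2, 1, 0, 1, 2, 3, 4, 3] \<in> G"
    "powers u [3, 2, 1, 0, 1, 2, 3, 4] \<in> G"
    "powers u [4, 3, 2, 1, 0, 1, 2, 3] \<in> G"
    "powers u [3, 4, 3, 2, 1, 0, 1, 2] \<in> G"
    "powers u [2, 3, 4, 3, 2, 1, 0, 1] \<in> G"
    "powers u [1, 2, 3, 4, 3, 2, 1, 0] \<in> G"
proof -
  have st: "s u = Q \<cdot> u" "t u = Q \<cdot> u" using assms by (simp_all add: eig_iff)
  have "(L * Q) \<cdot> u = (Q * (Q * (Q * Q))) \<cdot> u"
    using stst[of u] by (simp add: lin st mult.commute)
  note st = st this
  have "translates u \<subseteq> G" by (auto intro: G.translate)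
  then show "powers u [0, 1, 2, 3, 4, 3, 2, 1] \<in> G"
    "powers u [1, 0, 1, 2, 3, 4, 3, 2] \<in> G"
    "powers u [2, 1, 0, 1, 2, 3, 4, 3] \<in> G"
    "powers u [3, 2, 1, 0, 1, 2, 3, 4] \<in> G"
    "powers u [4, 3, 2, 1, 0, 1, 2, 3] \<in> G"
    "powers u [3, 4, 3, 2, 1, 0, 1, 2] \<in> G"
    "powers u [2, 3, 4, 3, 2, 1, 0, 1] \<in> G"
    "powers u [1, 2, 3, 4, 3, 2, 1, 0] \<in> G"
    by (simp_all add: translates_def powers_def eval_nat_numeral st lin ac_simps)
qed

lemma one_minus_Q8_unit: "(1 - Q ^ 2) * (1 - Q ^ 8) dvd 1"
proof -
  have "(1 - Q ^ 2) * (1 - Q ^ 8) = [:(1 - q * q) * (1 - q ^ 8):]"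
    by (simp add: Q_eq one_pCons eval_nat_numeral algebra_simps)
  then show ?thesis using q_square q_power8 by (simp add: is_unit_const_poly_iff dvd_field_iff)
qed

text \<open>
  This is a column of the inverse of the matrix just mentioned. Let \<open>R\<^sub>k\<close> be the octuple with entries
  \<open>u\<close>, \<open>q u\<close>, \<open>q\<^sup>2 u\<close>, \<open>q\<^sup>3 u\<close> at the four corners from \<open>k\<close> on, a multiple of a difference of two
  translates. Then \<open>R\<^sub>k - q R\<^sub>k\<^sub>+\<^sub>1\<close> has the entries \<open>u\<close> at the corner \<open>k\<close> and \<open>-q\<^sup>4 u\<close> at the opposite one;
  doing the same at the opposite corner and combining yields \<open>(1 - q\<^sup>8) u\<close> at \<open>k\<close> alone.
\<close>

lemma
  assumes "u \<in> eig s" "u \<in> eig t"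
  shows single_entry_3: "[0, 0, 0, u, 0, 0, 0, 0] \<in> G"
    and single_entry_4: "[0, 0, 0, 0, u, 0, 0, 0] \<in> G"
    and single_entry_5: "[0, 0, 0, 0, 0, u, 0, 0] \<in> G"
proof -
  have combination: "map2 (+) (map (smul (1 + Q ^ 2)) x0) (map2 (-) (map (smul (Q ^ 4 * (1 + Q ^ 2))) x4)
      (map2 (+) (map (smul Q) (map2 (+) x1 x7)) (map (smul (Q ^ 5)) (map2 (+) x3 x5)))) \<in> G"
    if "x0 \<in> G" "x1 \<in> G" "x3 \<in> G" "x4 \<in> G" "x5 \<in> G" "x7 \<in> G" for x0 x1 x3 x4 x5 x7
    using that by (intro G.add G_diff G.smul)
  note p = powers_in_G[OF assms]
  have "map (smul ((1 - Q ^ 2) * (1 - Q ^ 8))) [0, 0, 0, u, 0, 0, 0, 0] \<in> G"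
    using combination[OF p(4) p(5) p(7) p(8) p(1) p(3)]
    by (simp add: powers_def eval_nat_numeral algebra_simps)
  then show "[0, 0, 0, u, 0, 0, 0, 0] \<in> G" using one_minus_Q8_unit by (rule G_unit)
  have "map (smul ((1 - Q ^ 2) * (1 - Q ^ 8))) [0, 0, 0, 0, u, 0, 0, 0] \<in> G"
    using combination[OF p(5) p(6) p(8) p(1) p(2) p(4)]
    by (simp add: powers_def eval_nat_numeral algebra_simps)
  then show "[0, 0, 0, 0, u, 0, 0, 0] \<in> G" using one_minus_Q8_unit by (rule G_unit)
  have "map (smul ((1 - Q ^ 2) * (1 - Q ^ 8))) [0, 0, 0, 0, 0, u, 0, 0] \<in> G"
    using combination[OF p(6) p(7) p(1) p(2) p(3) p(5)]
    by (simp add: powers_def eval_nat_numeral algebra_simps)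
  then show "[0, 0, 0, 0, 0, u, 0, 0] \<in> G" using one_minus_Q8_unit by (rule G_unit)
qed

section \<open>Residual octuples\<close>

lemma neg_t_in_eig_iff: "- t c \<in> eig t \<longleftrightarrow> t c = Q \<cdot> c"
proof -
  have "- t c \<in> eig t \<longleftrightarrow> t (t c) = t (Q \<cdot> c)"
    by (simp add: eig_iff swap.s_minus t_smul)
  then show ?thesis using swap.s_inj[of "t c" "Q \<cdot> c"] by auto
qed

lemma residual_iff: "[0, 0, 0, a, b, c, 0, 0] \<in> K \<longleftrightarrow>
    a \<in> eig s \<and> b - t a \<in> eig t \<and> c - s b \<in> eig s \<and> c \<in> eig t"
  by (simp add: K_iff s_zero swap.s_zero zero_in_eig swap.zero_in_eig neg_t_in_eig_iff)
    (simp add: eig_iff)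

lemma eig_flip:
  assumes "c - s b \<in> eig s" shows "b - s c \<in> eig s"
proof -
  have "s (c - s b) \<in> eig s" using assms by (simp add: eig_iff s_smul)
  then have "s c - s (s b) \<in> eig s" unfolding s_diff .
  then have "(b - s (s b)) - (s c - s (s b)) \<in> eig s"
    by (rule subspace_diff[OF subspace_eig square_in_eig'])
  then show ?thesis by simp
qed

text \<open>
  The vectors \<open>e\<close> and \<open>f = s e\<close> span a submodule stable under both generators, on which the cubic relation
  for \<open>t\<close> gives one linear relation between \<open>e\<close> and \<open>f\<close>; together with its image under \<open>s\<close> it shows that
  \<open>L\<close> has only the eigenvalues \<open>q\<close>, \<open>-q\<close> and \<open>q\<^sup>3\<close>. Four half-octagons combine to an octuple in \<open>G\<close> supported
  on the same two corners and with the entry \<open>B(L) e\<close> at the first of them. Hence it differs from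
  \<open>B(L) (e, \<epsilon> e)\<close> by an octuple in \<open>K\<close> with a single entry. It remains that \<open>B\<close> does not vanish at the three
  eigenvalues, which is where \<open>q\<^sup>8 \<noteq> 1\<close> enters: the values there are, up to units,
  \<open>1\<close>, \<open>1 + q\<^sup>2\<close> and \<open>(1 + q\<^sup>4) (1 + q\<^sup>2)\<^sup>2\<close>.
\<close>

lemma eigen_pair_in_G:
  assumes e: "e \<in> eig t" and sse: "s (s e) = (Q + \<epsilon>) \<cdot> s e - (\<epsilon> * Q) \<cdot> e"
    and \<epsilon>: "\<epsilon> = 1 \<or> \<epsilon> = - 1"
  shows "[0, 0, 0, 0, e, \<epsilon> \<cdot> e, 0, 0] \<in> G"
proof -
  have \<epsilon>2: "\<epsilon> * \<epsilon> = 1" "\<epsilon> * (\<epsilon> * x) = x" for x using \<epsilon> by auto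
  define f where "f = s e"
  have te: "t e = Q \<cdot> e" using e by (simp add: eig_iff)
  define c where "c \<alpha> \<beta> = \<alpha> \<cdot> e + \<beta> \<cdot> f" for \<alpha> \<beta>
  have c_add: "c \<alpha> \<beta> + c \<alpha>' \<beta>' = c (\<alpha> + \<alpha>') (\<beta> + \<beta>')"
    and c_diff: "c \<alpha> \<beta> - c \<alpha>' \<beta>' = c (\<alpha> - \<alpha>') (\<beta> - \<beta>')"
    and c_smul: "p \<cdot> c \<alpha> \<beta> = c (p * \<alpha>) (p * \<beta>)" for p \<alpha> \<beta> \<alpha>' \<beta>'
    by (simp_all add: c_def algebra_simps)
  have c_cong: "c \<alpha> \<beta> = c \<alpha>' \<beta>'" if "\<alpha> = \<alpha>'" "\<beta> = \<beta>'" for \<alpha> \<beta> \<alpha>' \<beta>' using that by simp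
  have fc: "f = c 0 1" by (simp add: c_def)
  have sc: "s (c \<alpha> \<beta>) = c (- \<beta> * \<epsilon> * Q) (\<alpha> + \<beta> * (Q + \<epsilon>))" for \<alpha> \<beta>
    by (simp add: c_def lin sse f_def algebra_simps)
  have Qtf: "Q \<cdot> t f = c (L * (1 + \<epsilon> * Q)) (- \<epsilon> * L)"
  proof (rule s_inj)
    have "s (t f) = L \<cdot> e" using swap.tst_on_eig_s[OF te] by (simp add: f_def)
    then have "s (Q \<cdot> t f) = c (Q * L) 0" by (simp add: lin c_def)
    also have "\<dots> = s (c (L * (1 + \<epsilon> * Q)) (- \<epsilon> * L))"
      unfolding sc by (rule c_cong) (simp_all add: algebra_simps \<epsilon>2)
    finally show "s (Q \<cdot> t f) = s (c (L * (1 + \<epsilon> * Q)) (- \<epsilon> * L))" .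
  qed
  have Qtc: "Q \<cdot> t (c \<alpha> \<beta>) = c (Q * Q * \<alpha> + \<beta> * L * (1 + \<epsilon> * Q)) (- \<beta> * \<epsilon> * L)" for \<alpha> \<beta>
  proof -
    have "Q \<cdot> t (c \<alpha> \<beta>) = (Q * Q * \<alpha>) \<cdot> e + \<beta> \<cdot> Q \<cdot> t f"
      by (simp add: c_def lin te algebra_simps)
    then show ?thesis unfolding Qtf by (simp add: c_def algebra_simps)
  qed
  define A where "A = (L * L - Q * Q) * (\<epsilon> * L + Q * Q)"
  define C where "C = (L * L - Q * Q) * Q * (1 + \<epsilon> * Q)"
  \<comment> \<open>The cubic relation for \<open>t\<close> at \<open>f\<close>, transported by \<open>s\<close>, becomes \<open>A \<cdot> e = C \<cdot> f\<close>.\<close>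
  have "0 = Q \<cdot> t (Q \<cdot> t (Q \<cdot> t f)) -
      ((Q * Q) \<cdot> (Q \<cdot> t (Q \<cdot> t f)) + (Q * Q) \<cdot> (Q \<cdot> t f) - (Q * Q * Q * Q) \<cdot> f)"
    using arg_cong[OF t_cubic[of f], of "smul (Q * Q * Q)"] by (simp add: lin algebra_simps)
  also have "\<dots> = c ((L * L - Q * Q) * L * (1 + \<epsilon> * Q)) (- A)"
    unfolding fc Qtc c_add c_diff c_smul A_def by (rule c_cong) (simp_all add: algebra_simps \<epsilon>2)
  finally have "s (c ((L * L - Q * Q) * L * (1 + \<epsilon> * Q)) (- A)) = 0" by (simp add: lin flip: \<open>0 = _\<close>)
  then have "\<epsilon> \<cdot> s (c ((L * L - Q * Q) * L * (1 + \<epsilon> * Q)) (- A)) = 0" by simp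
  then have "Q \<cdot> c A (- C) = 0"
    unfolding sc c_smul A_def C_def
    by (subst (asm) c_cong[of _ "Q * ((L * L - Q * Q) * (\<epsilon> * L + Q * Q))"
        _ "Q * (- ((L * L - Q * Q) * Q * (1 + \<epsilon> * Q)))"])
     (simp_all add: algebra_simps \<epsilon>2)
  then have rel: "c A (- C) = 0" using Q_cancel[of "c A (- C)" 0] by simp
  \<comment> \<open>Eliminating \<open>f\<close> between this relation and its image under \<open>s\<close>.\<close>
  have "0 = (\<epsilon> * L + Q * Q - Q * (1 + \<epsilon> * Q) * (Q + \<epsilon>)) \<cdot> c A (- C) +
      (Q * (1 + \<epsilon> * Q)) \<cdot> s (c A (- C))"
    by (simp add: rel lin)
  also have "\<dots> = c ((L * L - Q * Q) * (L - Q) * (L - Q * Q * Q)) 0"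
    unfolding sc c_add c_smul A_def C_def by (rule c_cong) (simp_all add: algebra_simps \<epsilon>2)
  finally have kill: "((L * L - Q * Q) * (L - Q) * (L - Q * Q * Q)) \<cdot> e = 0" by (simp add: c_def)

  \<comment> \<open>\<open>w\<close> is \<open>q\<close> times the entry that the octuple \<open>1\<close> below has at the corner \<open>6\<close>; the octuple \<open>2\<close> removes it.\<close>
  define w where "w = c (L * (1 + \<epsilon> * Q)) (- \<epsilon> * L * (1 + \<epsilon> * Q))"
  have w: "w \<in> eig s" "L \<cdot> w \<in> eig s"
    unfolding eig_iff w_def sc c_smul by (rule c_cong; simp add: algebra_simps \<epsilon>2)+
  have Le: "L \<cdot> e \<in> eig t" using e subspace_scale swap.subspace_eig by blast
  have w_eq: "Q \<cdot> t f - (Q * L) \<cdot> f = w"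
    unfolding Qtf unfolding fc c_smul c_diff w_def by (rule c_cong) (simp_all add: algebra_simps \<epsilon>2)
  define B where "B = Q * Q * Q * (1 - L * L) * (1 - L * L) -
      L * (Q - L) * ((Q + L) * (\<epsilon> * L + Q * Q) - Q * L * (1 + \<epsilon> * Q) * (\<epsilon> + Q))"
  have "map2 (-) [0, 0, 0, 0, e, s e, t (s e), L \<cdot> e]
      [0, 0, 0, 0, L \<cdot> L \<cdot> e, t (s (L \<cdot> e)), s (L \<cdot> e), L \<cdot> e] \<in> G"
    by (intro G_diff half_up_4 half_down_7 e Le)
  then have 1: "[0, 0, 0, 0, (1 - L * L) \<cdot> e, s e - L \<cdot> t (s e), t (s e) - L \<cdot> s e, 0] \<in> G"
    by (simp add: lin scale_left_diff_distrib)
  have "map2 (-) [0, 0, 0, L \<cdot> w, s (t w), t w, w, 0]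
      [0, 0, 0, L \<cdot> w, t (L \<cdot> w), s (t (L \<cdot> w)), L \<cdot> L \<cdot> w, 0] \<in> G"
    by (intro G_diff half_up_3 half_down_6 w)
  then have 2: "[0, 0, 0, 0, s (t w) - L \<cdot> t w, t w - L \<cdot> s (t w), (1 - L * L) \<cdot> w, 0] \<in> G"
    by (simp add: lin scale_left_diff_distrib)
  define z where "z = (Q * (1 - L * L)) \<cdot> (s e - L \<cdot> t (s e)) - (t w - L \<cdot> s (t w))"
  have "(Q * (1 - L * L)) \<cdot> (t (s e) - L \<cdot> s e) = (1 - L * L) \<cdot> w"
    unfolding w_eq[symmetric] f_def by (simp add: algebra_simps)
  with G_diff[OF G.smul[OF 1, of "Q * (1 - L * L)"] 2]
  have "[0, 0, 0, 0, (Q * (1 - L * L) * (1 - L * L)) \<cdot> e - (s (t w) - L \<cdot> t w), z, 0, 0] \<in> G"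
    unfolding z_def by simp
  from G.smul[OF this, of "Q * Q"]
  have *: "[0, 0, 0, 0, (Q * Q * (Q * (1 - L * L) * (1 - L * L))) \<cdot> e -
      (Q * Q) \<cdot> (s (t w) - L \<cdot> t w), (Q * Q) \<cdot> z, 0, 0] \<in> G"
    by (simp add: scale_right_diff_distrib)
  have "B \<cdot> e - ((Q * Q * (Q * (1 - L * L) * (1 - L * L))) \<cdot> e - (Q * Q) \<cdot> (s (t w) - L \<cdot> t w))
    = c (B - Q * Q * (Q * (1 - L * L) * (1 - L * L))) 0 + Q \<cdot> s (Q \<cdot> t w) - (L * Q) \<cdot> (Q \<cdot> t w)"
    by (simp add: c_def lin algebra_simps)
  also have "\<dots> = L \<cdot> c A (- C)"
    unfolding w_def Qtc sc c_smul c_add c_diff B_def A_def C_def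
    by (rule c_cong) (simp_all add: algebra_simps \<epsilon>2)
  finally have "(Q * Q * (Q * (1 - L * L) * (1 - L * L))) \<cdot> e - (Q * Q) \<cdot> (s (t w) - L \<cdot> t w) = B \<cdot> e"
    by (simp add: rel)
  with * have BG: "[0, 0, 0, 0, B \<cdot> e, (Q * Q) \<cdot> z, 0, 0] \<in> G" by simp
  have eK: "[0, 0, 0, 0, B \<cdot> e, (B * \<epsilon>) \<cdot> e, 0, 0] \<in> K"
  proof -
    have "\<epsilon> \<cdot> e - s e \<in> eig s"
      by (simp add: eig_iff lin sse \<epsilon>2 algebra_simps)
    from subspace_scale[OF subspace_eig this, of B]
    have "(B * \<epsilon>) \<cdot> e - s (B \<cdot> e) \<in> eig s" by (simp add: lin scale_right_diff_distrib)
    moreover have "p \<cdot> e \<in> eig t" for p using e by (rule subspace_scale[OF swap.subspace_eig])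
    ultimately show ?thesis by (simp add: residual_iff zero_in_eig lin)
  qed
  have "[0, 0, 0, 0, 0, (B * \<epsilon>) \<cdot> e - (Q * Q) \<cdot> z, 0, 0] \<in> K"
    using K_diff[OF eK BG] by simp
  then have "(B * \<epsilon>) \<cdot> e - (Q * Q) \<cdot> z \<in> eig s" "(B * \<epsilon>) \<cdot> e - (Q * Q) \<cdot> z \<in> eig t"
    unfolding residual_iff by (simp_all add: lin)
  then have "[0, 0, 0, 0, 0, (B * \<epsilon>) \<cdot> e - (Q * Q) \<cdot> z, 0, 0] \<in> G" by (rule single_entry_5)
  from G.add[OF BG this]
  have BG': "map (smul B) [0, 0, 0, 0, e, \<epsilon> \<cdot> e, 0, 0] \<in> G" by simp
  have B: "poly B q \<noteq> 0" "poly B (- q) \<noteq> 0" "poly B (q * q * q) \<noteq> 0"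
  proof -
    define \<epsilon>' where "\<epsilon>' = poly \<epsilon> 0"
    have \<epsilon>': "poly \<epsilon> x = \<epsilon>'" "\<epsilon>' = 1 \<or> \<epsilon>' = - 1" for x using \<epsilon> by (auto simp: \<epsilon>'_def)
    have polyB: "poly B c = q * q * q * (1 - c * c) * (1 - c * c) -
        c * (q - c) * ((q + c) * (\<epsilon>' * c + q * q) - q * c * (1 + \<epsilon>' * q) * (\<epsilon>' + q))" for c
      by (simp add: B_def Q_eq L_eq \<epsilon>'(1) algebra_simps)
    have "poly B q = q * q * q * (1 - q * q) * (1 - q * q)"
      by (simp add: polyB)
    then show "poly B q \<noteq> 0" using q_nonzero q_square by simp
    have "poly B (- q) = q * q * q * (1 + \<epsilon>' * q) * (1 + \<epsilon>' * q) * (1 + q * q)"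
      using \<epsilon>'(2) unfolding polyB by (elim disjE) (simp_all add: algebra_simps)
    moreover have "1 + \<epsilon>' * q \<noteq> 0"
      using \<epsilon>'(2) q_square by (auto simp: add_eq_0_iff)
    ultimately show "poly B (- q) \<noteq> 0" using q_nonzero q_nonroots by simp
    have "poly B (q * q * q) = q * q * q * (1 - q * q) * (1 - q * q) *
        (1 + q * q * q * q) * (1 + q * q) * (1 + q * q)"
      using \<epsilon>'(2) unfolding polyB by (elim disjE) (simp_all add: algebra_simps)
    then show "poly B (q * q * q) \<noteq> 0" using q_nonzero q_square q_nonroots by simp
  qed
  have "map (smul 0) [v, s v, t (s v), s (t (s v)), (Q * L) \<cdot> v, t (s (t v)), s (t v), t v] \<in> G" for v
    by (rule G.smul, rule G.translate[of _ v]) (simp add: translates_def)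
  then have zero: "[0, 0, 0, 0, 0, 0, 0, 0] \<in> G" by simp
  let ?e = "[0, 0, 0, 0, e, \<epsilon> \<cdot> e, 0, 0]"
  have "map (smul ((L - [:q:]) * ((L - [:- q:]) * ((L - [:q:]) * ((L - [:q * q * q:]) * 1))))) ?e \<in> G"
  proof -
    have c: "[:q:] = Q" "[:- q:] = - Q" "[:q * q * q:] = Q * Q * Q" by (simp_all add: Q_eq)
    have "(L - [:q:]) * ((L - [:- q:]) * ((L - [:q:]) * ((L - [:q * q * q:]) * 1)))
        = (L * L - Q * Q) * (L - Q) * (L - Q * Q * Q)" (is "?N = _")
      unfolding c by (simp add: algebra_simps)
    then have N: "?N \<cdot> e = 0" by (simp only: kill)
    have "?N \<cdot> (\<epsilon> \<cdot> e) = \<epsilon> \<cdot> (?N \<cdot> e)" by (rule scale_left_commute)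
    then have "?N \<cdot> (\<epsilon> \<cdot> e) = 0" by (simp only: N scale_zero_right)
    with N zero show ?thesis by (simp only: list.map scale_zero_right)
  qed
  from this[THEN G_cancel_root[OF _ BG' B(1)], THEN G_cancel_root[OF _ BG' B(2)],
     THEN G_cancel_root[OF _ BG' B(1)], THEN G_cancel_root[OF _ BG' B(3)]]
  show ?thesis by simp
qed

text \<open>
  With \<open>e = b + c\<close> and \<open>e = b - c\<close>, the condition on the edge between the two entries says that
  \<open>s\<close> satisfies a quadratic relation at \<open>e\<close>.
\<close>

lemma pair_in_G:
  assumes "[0, 0, 0, 0, b, c, 0, 0] \<in> K"
  shows "[0, 0, 0, 0, b, c, 0, 0] \<in> G"
proof (rule G_unit)
  have b: "b \<in> eig t" and c: "c \<in> eig t" and cb: "c - s b \<in> eig s"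
    using assms unfolding residual_iff swap.s_zero by simp_all
  from cb have 1: "s c - s (s b) = Q \<cdot> c - Q \<cdot> s b"
    by (simp add: eig_iff s_diff s_smul scale_right_diff_distrib)
  from eig_flip[OF cb] have 2: "s b - s (s c) = Q \<cdot> b - Q \<cdot> s c"
    by (simp add: eig_iff s_diff s_smul scale_right_diff_distrib)
  have "[0, 0, 0, 0, b + c, 1 \<cdot> (b + c), 0, 0] \<in> G"
  proof (rule eigen_pair_in_G)
    show "b + c \<in> eig t" by (rule subspace_add[OF swap.subspace_eig b c])
    have ss: "s (s b) = s c - Q \<cdot> c + Q \<cdot> s b" "s (s c) = s b - Q \<cdot> b + Q \<cdot> s c"
      using 1 2 by (simp_all add: algebra_simps)
    show "s (s (b + c)) = (Q + 1) \<cdot> s (b + c) - (1 * Q) \<cdot> (b + c)"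
      by (simp only: s_add ss) (simp add: algebra_simps)
  qed simp
  moreover have "[0, 0, 0, 0, b - c, (- 1) \<cdot> (b - c), 0, 0] \<in> G"
  proof (rule eigen_pair_in_G)
    show "b - c \<in> eig t" by (rule subspace_diff[OF swap.subspace_eig b c])
    have ss: "s (s b) = s c - Q \<cdot> c + Q \<cdot> s b" "s (s c) = s b - Q \<cdot> b + Q \<cdot> s c"
      using 1 2 by (simp_all add: algebra_simps)
    show "s (s (b - c)) = (Q + - 1) \<cdot> s (b - c) - (- 1 * Q) \<cdot> (b - c)"
      by (simp only: s_diff ss) (simp add: algebra_simps)
  qed simp
  ultimately have "map2 (+) [0, 0, 0, 0, b + c, 1 \<cdot> (b + c), 0, 0]
      [0, 0, 0, 0, b - c, (- 1) \<cdot> (b - c), 0, 0] \<in> G"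
    by (rule G.add)
  moreover have "2 \<cdot> v = v + v" for v
    using scale_left_distrib[of 1 1 v] by simp
  ultimately show "map (smul 2) [0, 0, 0, 0, b, c, 0, 0] \<in> G" by simp
  show "(2 :: complex poly) dvd 1"
    by (simp add: numeral_poly is_unit_const_poly_iff dvd_field_iff)
qed

lemma K_smul:
  assumes "[0, 0, 0, a, b, c, 0, 0] \<in> K"
  shows "[0, 0, 0, p \<cdot> a, p \<cdot> b, p \<cdot> c, 0, 0] \<in> K"
proof -
  have "p \<cdot> b - t (p \<cdot> a) = p \<cdot> (b - t a)" "p \<cdot> c - s (p \<cdot> b) = p \<cdot> (c - s b)"
    by (simp_all add: lin scale_right_diff_distrib)
  with assms show ?thesis
    unfolding residual_iff by (simp add: subspace_scale[OF subspace_eig] subspace_scale[OF swap.subspace_eig])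
qed

text \<open>
  The half-octagon that starts with \<open>a\<close> ends with \<open>L a\<close>, one corner beyond the residual support. The
  half-octagon that starts there with \<open>L a\<close> and runs back removes this entry and ends with \<open>L\<^sup>2 a\<close>.
\<close>

lemma one_minus_LL_kills_residual:
  assumes "[0, 0, 0, a, b, c, 0, 0] \<in> K"
  shows "map (smul (1 - L * L)) [0, 0, 0, a, b, c, 0, 0] \<in> G"
proof -
  have a: "a \<in> eig s" "L \<cdot> a \<in> eig s" using assms subspace_scale[OF subspace_eig] unfolding residual_iff by simp_all
  have "map2 (-) [0, 0, 0, a, t a, s (t a), L \<cdot> a, 0] [0, 0, 0, L \<cdot> L \<cdot> a, s (t (L \<cdot> a)), t (L \<cdot> a), L \<cdot> a, 0] \<in> G"
    by (intro G_diff half_up_3 half_down_6 a)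
  then have E: "[0, 0, 0, (1 - L * L) \<cdot> a, t a - s (t (L \<cdot> a)), s (t a) - t (L \<cdot> a), 0, 0] \<in> G"
    by (simp add: scale_left_diff_distrib)
  from K_diff[OF K_smul[OF assms, of "1 - L * L"] E]
  have "[0, 0, 0, 0, (1 - L * L) \<cdot> b - (t a - s (t (L \<cdot> a))), (1 - L * L) \<cdot> c - (s (t a) - t (L \<cdot> a)), 0, 0] \<in> K"
    by simp
  from G.add[OF E pair_in_G[OF this]] show ?thesis by simp
qed

text \<open>
  If the components that the exchange relation controls are absent, the two outer entries satisfy
  \<open>t a = s c\<close>; this vector is fixed by \<open>s\<^sup>2\<close> and both generators act on it as \<open>L\<close>, so \<open>q L = stst = 1\<close> on it.
\<close>

lemma rigid_residual_in_G:
  assumes K: "[0, 0, 0, a, b, c, 0, 0] \<in> K"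
    and a: "t (t a) = a" "s (s (t a)) = t a" and c: "s (s c) = c" "t (t (s c)) = s c"
    and v: "s (s (b - t a)) - (b - t a) \<in> eig t"
  shows "map (smul (Q * L - 1)) [0, 0, 0, a, b, c, 0, 0] \<in> G"
proof -
  have K': "a \<in> eig s" "b - t a \<in> eig t" "b - s c \<in> eig s" "c \<in> eig t"
    using K eig_flip unfolding residual_iff by blast+
  define v1 where "v1 = b - s c"
  define v2 where "v2 = b - t a"
  have "s (s v2) - v2 = s (s b) - b" by (simp add: v2_def s_diff a)
  also have "\<dots> = s (s v1) - v1" by (simp add: v1_def s_diff c)
  also have "\<dots> = (Q * Q - 1) \<cdot> v1" by (rule eig_square) (simp add: v1_def K')
  finally have "(Q * Q - 1) \<cdot> v1 \<in> eig t" using v by (simp add: v2_def)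
  then have "(Q * Q - 1) \<cdot> t v1 = (Q * Q - 1) \<cdot> (Q \<cdot> v1)"
    by (simp add: eig_iff t_smul mult.commute)
  then have v1: "v1 \<in> eig t" unfolding eig_iff by (rule QQ_minus_one_cancel)
  have "(Q * Q - 1) \<cdot> v2 = t (t v2) - v2" by (rule swap.eig_square[symmetric]) (simp add: v2_def K')
  also have "\<dots> = t (t b) - b" by (simp add: v2_def swap.s_diff a)
  also have "\<dots> = t (t v1) - v1" by (simp add: v1_def swap.s_diff c)
  also have "\<dots> = (Q * Q - 1) \<cdot> v1" using v1 by (rule swap.eig_square)
  finally have "v2 = v1" by (rule QQ_minus_one_cancel)
  then have y: "s c = t a" by (simp add: v1_def v2_def)
  have sy: "s (t a) = L \<cdot> t a" using K'(1) a(1) by (rule square_fixed_eigenvector)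
  have ty: "t (t a) = L \<cdot> t a" using swap.square_fixed_eigenvector(1)[OF K'(4) c(1)] by (simp add: y)
  have LL: "(L * L) \<cdot> t a = t a" using a(2) by (simp add: sy s_smul)
  have "(Q * L) \<cdot> t a = s (t (s (t (t a))))" by (simp add: stst)
  also have "\<dots> = (L * L) \<cdot> (L * L) \<cdot> t a"
    by (simp only: ty sy s_smul t_smul scale_scale mult.assoc)
  also have "\<dots> = t a" by (simp only: LL)
  finally have 0: "(Q * L - 1) \<cdot> t a = 0" by (simp add: scale_left_diff_distrib)
  have "t ((Q * L - 1) \<cdot> a) = t 0" using 0 by (simp only: t_smul swap.s_zero)
  then have a0: "(Q * L - 1) \<cdot> a = 0" by (rule swap.s_inj)
  have "s ((Q * L - 1) \<cdot> c) = s 0" using 0 by (simp only: s_smul s_zero y)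
  then have c0: "(Q * L - 1) \<cdot> c = 0" by (rule s_inj)
  have "(Q * L - 1) \<cdot> b = (Q * L - 1) \<cdot> t a + (Q * L - 1) \<cdot> v1"
    by (simp add: v1_def y flip: scale_right_distrib)
  then have b0: "(Q * L - 1) \<cdot> b = (Q * L - 1) \<cdot> v1" by (simp only: 0 add_0)
  have "[0, 0, 0, 0, (Q * L - 1) \<cdot> v1, 0, 0, 0] \<in> G"
    using v1 K'(3) by (intro single_entry_4 subspace_scale[OF subspace_eig] subspace_scale[OF swap.subspace_eig])
      (simp_all add: v1_def)
  then show ?thesis by (simp only: list.map scale_zero_right a0 b0 c0)
qed

text \<open>
  Multiplication by \<open>(q\<^sup>2 - 1) exchange\<close> and subtraction of two octuples with a single entry makes the outer
  entries fixed by \<open>t\<^sup>2\<close> and \<open>s\<^sup>2\<close>. The factor \<open>L - q\<close> then removes the eigencomponents of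
  \<open>t a\<close> and \<open>s c\<close>, and another factor \<open>exchange\<close> moves those of \<open>b - t a\<close> into both eigenspaces.
\<close>

lemma residual_killed:
  assumes K: "[0, 0, 0, a, b, c, 0, 0] \<in> K"
  shows "map (smul ((Q * L - 1) * ((L - Q) * exchange) * ((Q * Q - 1) * exchange)))
    [0, 0, 0, a, b, c, 0, 0] \<in> G"
proof -
  have K': "a \<in> eig s" "c \<in> eig t" using K unfolding residual_iff by blast+
  define p where "p = (Q * Q - 1) * exchange"
  define u where "u = exchange \<cdot> (t (t a) - a)"
  define w where "w = exchange \<cdot> (s (s c) - c)"
  note u = exchange_common_eig[OF K'(1), folded u_def] and w = swap.exchange_common_eig[OF K'(2), folded w_def]
  have D: "[0, 0, 0, u, 0, w, 0, 0] \<in> G"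
    using G.add[OF single_entry_3[OF u] single_entry_5[OF w(2,1)]] by simp
  define a2 where "a2 = p \<cdot> a - u"
  define b2 where "b2 = p \<cdot> b"
  define c2 where "c2 = p \<cdot> c - w"
  have K2: "[0, 0, 0, a2, b2, c2, 0, 0] \<in> K"
    using K_diff[OF K_smul[OF K, of p] D] by (simp add: a2_def b2_def c2_def)
  have a2: "t (t a2) = a2"
  proof -
    have "t (t a2) - a2 = p \<cdot> (t (t a) - a) - (t (t u) - u)"
      by (simp add: a2_def swap.s_diff t_smul scale_right_diff_distrib)
    also have "t (t u) - u = p \<cdot> (t (t a) - a)"
      using swap.eig_square[OF u(2)] by (simp add: u_def p_def)
    finally show ?thesis by simp
  qed
  have c2: "s (s c2) = c2"
  proof -
    have "s (s c2) - c2 = p \<cdot> (s (s c) - c) - (s (s w) - w)"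
      by (simp add: c2_def s_diff s_smul scale_right_diff_distrib)
    also have "s (s w) - w = p \<cdot> (s (s c) - c)"
      using eig_square[OF w(2)] by (simp add: w_def p_def)
    finally show ?thesis by simp
  qed
  have K2': "a2 \<in> eig s" "b2 - t a2 \<in> eig t" "c2 \<in> eig t"
    using K2 unfolding residual_iff by blast+
  define m where "m = (L - Q) * exchange"
  have "map (smul (Q * L - 1)) [0, 0, 0, m \<cdot> a2, m \<cdot> b2, m \<cdot> c2, 0, 0] \<in> G"
  proof (rule rigid_residual_in_G)
    show "[0, 0, 0, m \<cdot> a2, m \<cdot> b2, m \<cdot> c2, 0, 0] \<in> K" using K2 by (rule K_smul)
    show "t (t (m \<cdot> a2)) = m \<cdot> a2" "s (s (m \<cdot> c2)) = m \<cdot> c2"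
      by (simp_all only: t_smul s_smul a2 c2)
    have "m \<cdot> (s (s (t a2)) - t a2) = exchange \<cdot> (L - Q) \<cdot> (s (s (t a2)) - t a2)"
      by (simp add: m_def mult.commute)
    then have "m \<cdot> (s (s (t a2)) - t a2) = 0"
      by (simp only: square_fixed_eigenvector(2)[OF K2'(1) a2] scale_zero_right)
    then show "s (s (t (m \<cdot> a2))) = t (m \<cdot> a2)"
      by (simp add: t_smul s_smul scale_right_diff_distrib)
    have "m \<cdot> (t (t (s c2)) - s c2) = exchange \<cdot> (L - Q) \<cdot> (t (t (s c2)) - s c2)"
      by (simp add: m_def mult.commute)
    then have "m \<cdot> (t (t (s c2)) - s c2) = 0"
      by (simp only: swap.square_fixed_eigenvector(2)[OF K2'(3) c2] scale_zero_right)
    then show "t (t (s (m \<cdot> c2))) = s (m \<cdot> c2)"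
      by (simp add: t_smul s_smul scale_right_diff_distrib)
    have "(L - Q) \<cdot> exchange \<cdot> (s (s (b2 - t a2)) - (b2 - t a2)) \<in> eig t"
      by (intro subspace_scale[OF swap.subspace_eig] swap.exchange_common_eig(1) K2'(2))
    then show "s (s (m \<cdot> b2 - t (m \<cdot> a2))) - (m \<cdot> b2 - t (m \<cdot> a2)) \<in> eig t"
      by (simp add: m_def t_smul s_smul s_diff scale_right_diff_distrib)
  qed
  from G.add[OF this G.smul[OF D, of "(Q * L - 1) * m"]]
  have "map (smul ((Q * L - 1) * m * p)) [0, 0, 0, a, b, c, 0, 0] \<in> G"
    by (simp add: a2_def b2_def c2_def scale_right_diff_distrib mult.assoc)
  then show ?thesis unfolding m_def p_def .
qed

lemma poly_L: "poly L c = c" and poly_Q: "poly Q c = q"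
  by (simp_all add: L_eq Q_eq)

lemma residual_in_G:
  assumes K: "[0, 0, 0, a, b, c, 0, 0] \<in> K"
  shows "[0, 0, 0, a, b, c, 0, 0] \<in> G" (is "?x \<in> G")
proof -
  let ?r = "(Q * L - 1) * ((L - Q) * exchange) * ((Q * Q - 1) * exchange)"
  have q1: "q \<noteq> 1" "- 1 \<noteq> q" "- q \<noteq> 1"
    using q_square by (auto simp: minus_equation_iff[of q])
  have "poly ?r 1 = (q - 1) * ((1 - q) * ((1 - q * q) * (1 - q))) *
      ((q * q - 1) * ((1 - q * q) * (1 - q)))"
    by (simp add: exchange_def poly_L poly_Q)
  then have r1: "poly ?r 1 \<noteq> 0" using q_square q1 by simp
  have "poly ?r (- 1) = (- q - 1) * ((- 1 - q) * (- ((1 - q * q) * (- 1 - q)))) *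
      ((q * q - 1) * (- ((1 - q * q) * (- 1 - q))))"
    by (simp add: exchange_def poly_L poly_Q)
  then have r2: "poly ?r (- 1) \<noteq> 0" using q_square q1 by simp
  have "(L - [:1:]) * ((L - [:- 1:]) * 1) = (- 1) * (1 - L * L)"
    by (simp add: L_eq one_pCons)
  then have "map (smul ((L - [:1:]) * ((L - [:- 1:]) * 1))) ?x =
      map (smul (- 1)) (map (smul (1 - L * L)) ?x)"
    by (simp only: map_map o_def scale_scale)
  then have "map (smul ((L - [:1:]) * ((L - [:- 1:]) * 1))) ?x \<in> G"
    using G.smul[OF one_minus_LL_kills_residual[OF K], of "- 1"] by (simp only:)
  from this[THEN G_cancel_root[OF _ residual_killed[OF K] r1],
      THEN G_cancel_root[OF _ residual_killed[OF K] r2]]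
  show ?thesis by simp
qed

end

context B2_cubic begin

text \<open>
  One translate clears the corner \<open>0\<close>. Then the entries at its two neighbours lie in the
  eigenspaces of the adjacent edges, so half-octagons pointing away from \<open>0\<close> clear them, and so
  on for the next two corners.
\<close>

lemma K_subset_G: "K \<subseteq> G"
proof
  have 2: "[0, 0, x2, x3, x4, x5, x6, 0] \<in> G"
    if x: "[0, 0, x2, x3, x4, x5, x6, 0] \<in> K" for x2 x3 x4 x5 x6
  proof -
    have x2: "x2 \<in> eig t" using x by (simp add: K_iff swap.s_zero)
    have "s x6 = Q \<cdot> x6" using x by (simp add: K_iff s_zero swap.s_zero swap.neg_t_in_eig_iff)
    then have x6: "x6 \<in> eig s" by (simp add: eig_iff)
    have "[0, 0, 0, x3 - s x2 - L \<cdot> x6, x4 - t (s x2) - s (t x6), x5 - L \<cdot> x2 - t x6, 0, 0] \<in> G"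
      using K_diff[OF K_diff[OF x half_up_2[OF x2]] half_down_6[OF x6]] by (intro residual_in_G) simp
    from G.add[OF half_up_2[OF x2] G.add[OF half_down_6[OF x6] this]] show ?thesis by simp
  qed
  have 1: "[0, x1, x2, x3, x4, x5, x6, x7] \<in> G"
    if x: "[0, x1, x2, x3, x4, x5, x6, x7] \<in> K" for x1 x2 x3 x4 x5 x6 x7
  proof -
    have "t x7 = Q \<cdot> x7" and x1: "x1 \<in> eig s"
      using x by (simp_all add: K_iff s_zero neg_t_in_eig_iff)
    then have x7: "x7 \<in> eig t" by (simp add: eig_iff)
    have "[0, 0, x2 - t x1, x3 - s (t x1), x4 - L \<cdot> x1 - L \<cdot> x7, x5 - t (s x7), x6 - s x7, 0] \<in> G"
      using K_diff[OF K_diff[OF x half_up_1[OF x1]] half_down_7[OF x7]] by (intro 2) simp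
    from G.add[OF half_up_1[OF x1] G.add[OF half_down_7[OF x7] this]] show ?thesis by simp
  qed
  fix x assume "x \<in> K"
  then obtain x0 x1 x2 x3 x4 x5 x6 x7 where x: "x = [x0, x1, x2, x3, x4, x5, x6, x7]"
    unfolding K_def by blast
  have g: "[x0, s x0, t (s x0), s (t (s x0)), (Q * L) \<cdot> x0, t (s (t x0)), s (t x0), t x0] \<in> G"
    by (rule G.translate[of _ x0]) (simp add: translates_def)
  have "[0, x1 - s x0, x2 - t (s x0), x3 - s (t (s x0)), x4 - (Q * L) \<cdot> x0,
      x5 - t (s (t x0)), x6 - s (t x0), x7 - t x0] \<in> G"
    using K_diff[OF \<open>x \<in> K\<close>[unfolded x] g] by (intro 1) simp
  from G.add[OF g this] show "x \<in> G" unfolding x by simp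
qed

end

section \<open>The module over the polynomials in a linear operator\<close>

text \<open>Horner's scheme for \<open>p(f) v\<close>.\<close>

definition poly_action :: "(complex \<Rightarrow> 'v \<Rightarrow> 'v::ab_group_add) \<Rightarrow> ('v \<Rightarrow> 'v) \<Rightarrow>
    complex poly \<Rightarrow> 'v \<Rightarrow> 'v" where
  "poly_action scale f p v = fold_coeffs (\<lambda>c u. scale c v + f u) p 0"

context
  fixes scale :: "complex \<Rightarrow> 'v \<Rightarrow> 'v::ab_group_add" and f :: "'v \<Rightarrow> 'v"
  assumes vs: "vector_space scale" and f: "Vector_Spaces.linear scale scale f"
begin

interpretation vector_space scale by (rule vs)
interpretation f: Vector_Spaces.linear scale scale f by (rule f)

lemma poly_action_0: "poly_action scale f 0 v = 0"
  by (simp add: poly_action_def)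

lemma poly_action_pCons:
  "poly_action scale f (pCons c p) v = scale c v + f (poly_action scale f p v)"
  by (cases "c = 0 \<and> p = 0") (auto simp: poly_action_def f.zero)

lemma poly_action_add_left:
  "poly_action scale f (p + r) v = poly_action scale f p v + poly_action scale f r v"
  by (induction p r rule: poly_induct2) (simp_all add: poly_action_0 poly_action_pCons f.add algebra_simps)

lemma poly_action_smult:
  "poly_action scale f (smult c p) v = scale c (poly_action scale f p v)"
  by (induction p) (simp_all add: poly_action_0 poly_action_pCons f.scale algebra_simps)

lemma poly_action_commute:
  assumes "\<And>u. g (f u) = f (g u)" "Vector_Spaces.linear scale scale g"
  shows "g (poly_action scale f p v) = poly_action scale f p (g v)"
proof -
  interpret g: Vector_Spaces.linear scale scale g by (rule assms(2))
  show ?thesis by (induction p) (simp_all add: poly_action_0 poly_action_pCons g.add g.scale g.zero assms(1))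
qed

lemma module_poly_action: "module (poly_action scale f)"
proof
  show "poly_action scale f p (u + v) = poly_action scale f p u + poly_action scale f p v" for p u v
    by (induction p) (simp_all add: poly_action_0 poly_action_pCons f.add algebra_simps)
  show "poly_action scale f (p + r) v = poly_action scale f p v + poly_action scale f r v" for p r v
    by (rule poly_action_add_left)
  show "poly_action scale f p (poly_action scale f r v) = poly_action scale f (p * r) v" for p r v
    by (induction p) (simp_all add: poly_action_0 poly_action_pCons poly_action_add_left poly_action_smult)
  show "poly_action scale f 1 v = v" for v
    by (simp add: one_pCons poly_action_pCons poly_action_0 f.zero)
qed

end

section \<open>The canonical section and the octagon\<close>

lemma lmul_length:
  assumes "ss \<in> set nfs"
  shows "length (lmul s ss) = Suc (length ss) \<or> length ss = Suc (length (lmul s ss))"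
  using assms by (cases s) (auto simp: nfs_def lmul_def)

text \<open>
  Left multiplication by a generator changes the length by one, and \<open>\<tau>\<close> is multiplicative in the direction
  in which the length grows.
\<close>

lemma tau_wgen_add:
  "tau (wgen s + u) = bgen s + tau u \<or> tau u = bgen s + tau (wgen s + u)"
proof -
  have nf: "nf (wgen s + u) = lmul s (nf u)"
    by (metis lmul(1,3) nf_props(1,2) nf_wprod)
  have "[s] \<in> set nfs" by (cases s) (auto simp: nfs_def)
  then have 1: "cox_length (wgen s) = 1" using nf_wprod[of "[s]"] by (simp add: nf_props(3))
  have up: "tau (wgen s + w) = bgen s + tau w" if "cox_length (wgen s + w) = Suc (cox_length w)" for w
    using is_section_tau that by (simp add: is_section_def 1)
  have "cox_length (wgen s + u) = Suc (cox_length u) \<or> cox_length u = Suc (cox_length (wgen s + u))"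
    using lmul_length[OF nf_props(1), of s u] by (simp add: nf_props(3) nf)
  then show ?thesis using up[of u] up[of "wgen s + u"] by (auto simp: wgen_square')
qed

text \<open>Each corner is obtained from the preceding one by left multiplication by \<open>s\<close> and \<open>t\<close> in turn.\<close>

definition corners :: "coxB2 list" where
  "corners = map wprod [[], [S1], [S2, S1], [S1, S2, S1], [S1, S2, S1, S2],
     [S2, S1, S2], [S1, S2], [S2]]"

lemma set_corners: "w \<in> set corners"
  using nf_props(1,2)[of w] by (auto simp: nfs_def corners_def)

lemma eq_on_corners:
  assumes "map x corners = map y corners" shows "x = y"
  using assms set_corners by (auto simp: map_eq_conv fun_eq_iff)

lemma tau_nf: "tau w = bprod (nf w)"
  by (rule is_section_unique[OF is_section_tau])

lemma act_diff: "act (a - b) p = act a (act (- b) p)"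
  using act_plus[of a "- b" p] by simp

section \<open>Representations of the cubic Hecke algebra\<close>

lemma cubic_relation:
  assumes "hecke_rep scale q \<phi>"
  shows "restrict_to_braid q \<phi> (bgen s)
      (restrict_to_braid q \<phi> (bgen s) (restrict_to_braid q \<phi> (bgen s) v))
    = scale q (restrict_to_braid q \<phi> (bgen s) (restrict_to_braid q \<phi> (bgen s) v))
      + restrict_to_braid q \<phi> (bgen s) v - scale q v"
proof -
  interpret I: ideal "cubic_ideal q" braid_algebra by (rule ideal_cubic_ideal)
  define \<Phi> where "\<Phi> a = \<phi> (hecke_class q a)" for a
  have car: "hecke_class q a \<in> carrier (cubic_hecke q)" for a
    by (auto simp: cubic_hecke_def FactRing_def hecke_class_def braid_algebra_def
        A_RCOSETS_def RCOSETS_def a_r_coset_def)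
  have mult: "hecke_class q a \<otimes>\<^bsub>cubic_hecke q\<^esub> hecke_class q b = hecke_class q (a * b)" for a b
    using I.rcoset_mult_add[of a b]
    by (simp add: cubic_hecke_def FactRing_def hecke_class_def braid_algebra_def)
  have add: "hecke_class q a \<oplus>\<^bsub>cubic_hecke q\<^esub> hecke_class q b = hecke_class q (a + b)" for a b
    using I.a_rcos_sum[of a b]
    by (simp add: cubic_hecke_def FactRing_def hecke_class_def braid_algebra_def)
  have hom: "\<phi> \<in> ring_hom (cubic_hecke q) (End_ring scale)"
    and const: "\<Phi> (const_alg c) = scale c" for c
    using assms by (simp_all add: hecke_rep_def \<Phi>_def)
  have \<Phi>_mult: "\<Phi> (a * b) v = \<Phi> a (\<Phi> b v)" for a b v
    using ring_hom_mult[OF hom car car, of a b] by (simp add: mult \<Phi>_def End_ring_def)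
  have \<Phi>_add: "\<Phi> (a + b) v = \<Phi> a v + \<Phi> b v" for a b v
    using ring_hom_add[OF hom car car, of a b] by (simp add: add \<Phi>_def End_ring_def)
  interpret vector_space scale using assms by (simp add: hecke_rep_def)
  let ?s = "in_alg (bgen s)"
  define x where "x = (?s - const_alg q) * (?s ^ 2 - 1)"
  have "x \<in> cubic_ideal q"
    unfolding cubic_ideal_def x_def
    by (rule subsetD[OF ring.genideal_self[OF ring_braid_algebra]]) (auto simp: braid_algebra_def)
  then have "hecke_class q x = hecke_class q 0"
    unfolding hecke_class_def
    using I.a_rcos_const[of x] I.a_rcos_const[of 0]
      additive_subgroup.zero_closed[OF ideal.axioms(1)[OF ideal_cubic_ideal[of q]]]
    by (simp add: braid_algebra_def)
  then have x0: "\<Phi> x v = 0"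
    using const[of 0] by (simp add: \<Phi>_def fun_eq_iff)
  have "?s * (?s * ?s) + const_alg q = x + (const_alg q * (?s * ?s) + ?s)"
    by (simp add: x_def algebra_simps power2_eq_square)
  then have "\<Phi> (?s * (?s * ?s) + const_alg q) v = \<Phi> (x + (const_alg q * (?s * ?s) + ?s)) v"
    by (simp only:)
  then have "\<Phi> ?s (\<Phi> ?s (\<Phi> ?s v)) + scale q v = scale q (\<Phi> ?s (\<Phi> ?s v)) + \<Phi> ?s v"
    by (simp only: \<Phi>_add \<Phi>_mult const x0 add_0)
  then show ?thesis by (simp add: restrict_to_braid_def \<Phi>_def algebra_simps)
qed


context
  fixes scale :: "complex \<Rightarrow> 'v \<Rightarrow> 'v::ab_group_add" and q :: complex and \<rho> :: "braid \<Rightarrow> 'v \<Rightarrow> 'v"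
  assumes vs: "vector_space scale" and rep: "braid_rep scale \<rho>"
    and cubic: "\<And>s v. \<rho> (bgen s) (\<rho> (bgen s) (\<rho> (bgen s) v)) =
      scale q (\<rho> (bgen s) (\<rho> (bgen s) v)) + \<rho> (bgen s) v - scale q v"
begin

interpretation vector_space scale by (rule vs)

lemma rho_linear: "Vector_Spaces.linear scale scale (\<rho> b)"
  and rho_0: "\<rho> 0 v = v" and rho_add: "\<rho> (a + b) v = \<rho> a (\<rho> b v)"
  using rep by (simp_all add: braid_rep_def)

lemma rho_vadd: "\<rho> b (u + v) = \<rho> b u + \<rho> b v" and rho_scale: "\<rho> b (scale c u) = scale c (\<rho> b u)"
  and rho_zero: "\<rho> b 0 = 0"
proof -
  interpret r: Vector_Spaces.linear scale scale "\<rho> b" by (rule rho_linear)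
  show "\<rho> b (u + v) = \<rho> b u + \<rho> b v" "\<rho> b (scale c u) = scale c (\<rho> b u)" "\<rho> b 0 = 0"
    by (simp_all add: r.add r.scale r.zero)
qed

abbreviation "fscale \<equiv> (\<lambda>c (x :: coxB2 \<Rightarrow> 'v) w. scale c (x w))"

interpretation fs: module fscale
  by unfold_locales (simp_all add: fun_eq_iff algebra_simps)

abbreviation "translates_span \<equiv> fs.span (\<Union>y. range (iota \<rho> y))"

lemma subspace_V_sub: "subspace (V_sub \<rho> s)"
proof -
  interpret r: Vector_Spaces.linear scale scale "\<rho> (bgen s)" by (rule rho_linear)
  show ?thesis
  proof (rule subspaceI)
    show "0 \<in> V_sub \<rho> s" unfolding V_sub_def by (rule image_eqI[of _ _ 0]) (simp_all add: r.zero)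
    fix x y assume "x \<in> V_sub \<rho> s" "y \<in> V_sub \<rho> s"
    then obtain u v where "x = \<rho> (bgen s) (\<rho> (bgen s) u) - u" "y = \<rho> (bgen s) (\<rho> (bgen s) v) - v"
      unfolding V_sub_def by auto
    then show "x + y \<in> V_sub \<rho> s" unfolding V_sub_def
      by (intro image_eqI[of _ _ "u + v"]) (simp_all add: r.add)
  next
    fix c x assume "x \<in> V_sub \<rho> s"
    then obtain u where "x = \<rho> (bgen s) (\<rho> (bgen s) u) - u"
      unfolding V_sub_def by auto
    then show "scale c x \<in> V_sub \<rho> s" unfolding V_sub_def
      by (intro image_eqI[of _ _ "scale c u"]) (simp_all add: r.scale scale_right_diff_distrib)
  qed
qed

text \<open>
  If \<open>\<tau>(s u) \<noteq> s \<tau>(u)\<close>, then \<open>\<tau>(u) = s \<tau>(s u)\<close>, and the two sides of the edge differ by an element of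
  the image of \<open>s\<^sup>2 - 1\<close>.
\<close>

lemma iota_in_K_W: "iota \<rho> y v \<in> K_W \<rho>"
  unfolding K_W_def
proof (intro CollectI allI)
  fix s w
  interpret r: Vector_Spaces.linear scale scale "\<rho> (bgen s)" by (rule rho_linear)
  have eq: "wgen s + w - y = wgen s + (w - y)" by (simp add: add_diff_eq)
  show "iota \<rho> y v (wgen s + w) - \<rho> (bgen s) (iota \<rho> y v w) \<in> V_sub \<rho> s"
  proof (cases "tau (wgen s + (w - y)) = bgen s + tau (w - y)")
    case True
    then show ?thesis using subspace_0[OF subspace_V_sub] by (simp add: iota_def eq rho_add)
  next
    case False
    then have "tau (w - y) = bgen s + tau (wgen s + (w - y))" using tau_wgen_add by blast
    then have "iota \<rho> y v (wgen s + w) - \<rho> (bgen s) (iota \<rho> y v w)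
      = \<rho> (bgen s) (\<rho> (bgen s) u) - u" if "u = - iota \<rho> y v (wgen s + w)" for u
      using that by (simp add: iota_def eq rho_add r.neg)
    then show ?thesis unfolding V_sub_def by blast
  qed
qed

lemma translates_span_subset_K_W: "translates_span \<subseteq> K_W \<rho>"
proof (rule fs.span_minimal)
  show "(\<Union>y. range (iota \<rho> y)) \<subseteq> K_W \<rho>" using iota_in_K_W by auto
  have *: "(x + y) (wgen s + w) - \<rho> (bgen s) ((x + y) w)
      = (x (wgen s + w) - \<rho> (bgen s) (x w)) + (y (wgen s + w) - \<rho> (bgen s) (y w))"
    "scale c (x (wgen s + w)) - \<rho> (bgen s) (scale c (x w)) = scale c (x (wgen s + w) - \<rho> (bgen s) (x w))"
    for x y :: "coxB2 \<Rightarrow> 'v" and s w c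
    by (simp_all add: rho_vadd rho_scale algebra_simps)
  show "fs.subspace (K_W \<rho>)"
  proof (rule fs.subspaceI)
    show "0 \<in> K_W \<rho>" by (simp add: K_W_def rho_zero subspace_0[OF subspace_V_sub])
    show "x + y \<in> K_W \<rho>" if "x \<in> K_W \<rho>" "y \<in> K_W \<rho>" for x y
      using that unfolding K_W_def mem_Collect_eq * by (blast intro: subspace_add[OF subspace_V_sub])
    show "fscale c x \<in> K_W \<rho>" if "x \<in> K_W \<rho>" for c x
      using that unfolding K_W_def mem_Collect_eq * by (blast intro: subspace_scale[OF subspace_V_sub])
  qed
qed

text \<open>
  For \<open>q = 0\<close> the cubic relation and invertibility give \<open>s\<^sup>2 = 1\<close>, so all \<open>V\<^sub>s\<close> vanish and every element of
  \<open>K\<^sub>W(V)\<close> is the translate of its value at the neutral element.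
\<close>

lemma K_W_subset_span_q_zero:
  assumes "q = 0" shows "K_W \<rho> \<subseteq> translates_span"
proof
  fix x assume x: "x \<in> K_W \<rho>"
  have "\<rho> (bgen s) (\<rho> (bgen s) (\<rho> (- bgen s) v)) = \<rho> (- bgen s) v" for s v
  proof -
    have sq: "\<rho> (bgen s) (\<rho> (bgen s) (\<rho> (bgen s) u)) = \<rho> (bgen s) u" for u
      using cubic[of s u] by (simp add: assms)
    have inv: "\<rho> (bgen s) (\<rho> (- bgen s) u) = u" for u
      using rho_add[of "bgen s" "- bgen s" u] by (simp add: rho_0)
    show ?thesis using sq[of "\<rho> (- bgen s) (\<rho> (- bgen s) v)"] by (simp add: inv)
  qed
  moreover have "\<rho> (- bgen s) (\<rho> (bgen s) v) = v" for s v
    using rho_add[of "- bgen s" "bgen s" v] by (simp add: rho_0)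
  ultimately have "\<rho> (bgen s) (\<rho> (bgen s) v) = v" for s v by metis
  then have step: "x (wgen s + w) = \<rho> (bgen s) (x w)" for s w
    using x by (simp add: K_W_def V_sub_def)
  have "x (wprod ss) = \<rho> (bprod ss) (x 0)" for ss
    by (induction ss) (simp_all add: rho_0 rho_add step)
  then have "x = iota \<rho> 0 (x 0)"
    by (auto simp: iota_def fun_eq_iff tau_nf) (metis nf_props(2))
  then show "x \<in> translates_span" by (metis UN_iff UNIV_I fs.span_base rangeI)
qed

abbreviation "S \<equiv> \<rho> (bgen S1)"
abbreviation "T \<equiv> \<rho> (bgen S2)"
abbreviation "act_poly \<equiv> poly_action scale (\<lambda>v. scale (inverse q) (S (T (S (T v)))))"

lemma rho_braid: "T (S (T (S v))) = S (T (S (T v)))"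
  using arg_cong[OF bgen_braid, of "\<lambda>b. \<rho> b v"] by (simp add: rho_add)

lemma linear_central: "Vector_Spaces.linear scale scale (\<lambda>v. scale (inverse q) (S (T (S (T v)))))"
  by unfold_locales (simp_all add: rho_vadd rho_scale algebra_simps)

lemma act_poly_const: "act_poly [:c:] v = scale c v"
  by (simp add: poly_action_pCons[OF vs linear_central] poly_action_0[OF vs linear_central] rho_zero)

lemma act_poly_central:
  assumes "q \<noteq> 0" shows "act_poly ([:q:] * [:0, 1:]) v = S (T (S (T v)))"
  using assms
  by (simp add: poly_action_pCons[OF vs linear_central] poly_action_0[OF vs linear_central] rho_zero rho_scale)

lemma rho_gen_act_poly: "\<rho> (bgen g) (act_poly p v) = act_poly p (\<rho> (bgen g) v)"
proof (rule poly_action_commute[OF vs linear_central _ rho_linear])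
  show "\<rho> (bgen g) (scale (inverse q) (S (T (S (T u))))) = scale (inverse q) (S (T (S (T (\<rho> (bgen g) u)))))" for u
    by (cases g) (simp_all add: rho_scale rho_braid)
qed

text \<open>
  The central element acts through the indeterminate only up to the factor \<open>q\<close>, so that its action on the
  common eigenvectors and the half-octagons has no denominators.
\<close>

lemma B2_cubic_act_poly:
  assumes "q \<noteq> 0" "q ^ 8 \<noteq> 1"
  shows "B2_cubic act_poly q [:q:] [:0, 1:] S T"
proof (rule B2_cubic.intro)
  show "module act_poly" by (rule module_poly_action[OF vs linear_central])
  show "B2_cubic_axioms act_poly q [:q:] [:0, 1:] S T"
    by (rule B2_cubic_axioms.intro)
      (simp_all only: assms rho_gen_act_poly rho_vadd act_poly_const cubic act_poly_central[OF assms(1)] rho_braid simp_thms)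
qed

lemma translates_are_iota:
  assumes "q \<noteq> 0" "q ^ 8 \<noteq> 1"
    and "xs \<in> B2_cubic.translates act_poly [:q:] [:0, 1:] S T v"
  shows "\<exists>y. xs = map (iota \<rho> y v) corners"
proof -
  interpret B: B2_cubic act_poly q "[:q:]" "[:0, 1:]" S T by (rule B2_cubic_act_poly) (rule assms)+
  have *: "B.translates v = set (map (\<lambda>y. map (iota \<rho> y v) corners) corners)"
    unfolding B.translates_def act_poly_central[OF assms(1)] corners_def
    by (simp add: iota_def tau_nf nf_def act_diff minus_add act_plus act_wgen act_0
        wgen_uminus rho_add rho_0 del: mult_pCons_left mult_pCons_right)
  then show ?thesis using assms(3) by auto
qed

text \<open>
  An element of \<open>K\<^sub>W(V)\<close> is determined by its octuple of values at the corners, and this octuple lies in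
  \<open>G\<close>. The set \<open>G\<close> is closed under multiplication by polynomials in the central element, which maps a
  translate to a translate because it commutes with the braid group; hence octuples in \<open>G\<close> come
  from the span over the complex numbers.
\<close>

lemma K_W_subset_span:
  assumes "q \<noteq> 0" "q ^ 8 \<noteq> 1"
  shows "K_W \<rho> \<subseteq> translates_span"
proof
  interpret B: B2_cubic act_poly q "[:q:]" "[:0, 1:]" S T by (rule B2_cubic_act_poly) (rule assms)+
  have span_act: "(\<lambda>w. act_poly p (x w)) \<in> translates_span" if "x \<in> translates_span" for p x
    using that
  proof (induction rule: fs.span_induct_alt)
    case base
    have "(\<lambda>w. act_poly p ((0 :: coxB2 \<Rightarrow> 'v) w)) = 0" by (rule ext) simp
    then show ?case using fs.span_zero by simp
  next
    case (step c x y)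
    then obtain z v where x: "x = iota \<rho> z v" by auto
    have "\<rho> (bprod ss) (act_poly p v) = act_poly p (\<rho> (bprod ss) v)" for ss
      by (induction ss) (simp_all add: rho_0 rho_add rho_gen_act_poly)
    then have "(\<lambda>w. act_poly p (x w)) = iota \<rho> z (act_poly p v)"
      by (simp add: x iota_def tau_nf)
    then have "(\<lambda>w. act_poly p (x w)) \<in> translates_span" by (auto intro: fs.span_base)
    then have "fscale c (\<lambda>w. act_poly p (x w)) + (\<lambda>w. act_poly p (y w)) \<in> translates_span"
      using step by (intro fs.span_add fs.span_scale)
    moreover have "act_poly p (scale c u) = scale c (act_poly p u)" for u
      using B.scale_left_commute[of p "[:c:]" u] by (simp only: act_poly_const)
    ultimately show ?case by (simp add: plus_fun_def B.scale_right_distrib)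
  qed
  have span: "\<exists>x\<in>translates_span. map x corners = xs" if "xs \<in> B.G" for xs
    using that
  proof (induction rule: B.G.induct)
    case (translate x v)
    then obtain y where "map (iota \<rho> y v) corners = x" using translates_are_iota[OF assms] by blast
    moreover have "iota \<rho> y v \<in> translates_span" by (rule fs.span_base) blast
    ultimately show ?case by blast
  next
    case (add x y)
    then obtain f g where fg: "f \<in> translates_span" "map f corners = x" "g \<in> translates_span" "map g corners = y"
      by blast
    have "map (f + g) corners = map2 (+) x y"
      unfolding fg(2,4)[symmetric] by (simp add: zip_map_map zip_same_conv_map)
    then show ?case using fs.span_add[OF fg(1,3)] by blast
  next
    case (smul x p)
    then obtain f where f: "f \<in> translates_span" "map f corners = x" by blast
    have "map (\<lambda>w. act_poly p (f w)) corners = map (act_poly p) x"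
      unfolding f(2)[symmetric] by simp
    then show ?case using span_act[OF f(1)] by blast
  qed
  fix x assume x: "x \<in> K_W \<rho>"
  have V: "V_sub \<rho> S1 \<subseteq> B.eig S" "V_sub \<rho> S2 \<subseteq> B.eig T"
    using B.square_in_eig B.swap.square_in_eig by (auto simp: V_sub_def)
  have step: "x (wgen S1 + w) - S (x w) \<in> B.eig S" "x (wgen S2 + w) - T (x w) \<in> B.eig T" for w
    using x V unfolding K_W_def by blast+
  have "map x corners \<in> B.K"
    unfolding corners_def list.map B.K_iff
    using step(1)[of "wprod []"] step(2)[of "wprod [S1]"] step(1)[of "wprod [S2, S1]"]
      step(2)[of "wprod [S1, S2, S1]"] step(1)[of "wprod [S1, S2, S1, S2]"]
      step(2)[of "wprod [S2, S1, S2]"] step(1)[of "wprod [S1, S2]"] step(2)[of "wprod [S2]"]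
    by (simp add: wgen_square wgen_square' wgen_braid)
  then obtain x' where "x' \<in> translates_span" "map x' corners = map x corners"
    using B.K_subset_G span by blast
  then show "x \<in> translates_span" using eq_on_corners by metis
qed

end

theorem theorem11p6p2:
  fixes scale :: "complex \<Rightarrow> 'v \<Rightarrow> 'v::ab_group_add"
    and q :: complex
    and \<phi> :: "(braid \<Rightarrow>\<^sub>0 complex) set \<Rightarrow> 'v \<Rightarrow> 'v"
  assumes "q ^ 8 \<noteq> 1"
    and "hecke_rep scale q \<phi>"
  shows "good scale (restrict_to_braid q \<phi>)"
proof -
  have vs: "vector_space scale" using assms(2) by (simp add: hecke_rep_def)
  let ?\<rho> = "restrict_to_braid q \<phi>"
  note hyps = vs braid_rep_restrict[OF assms(2)] cubic_relation[OF assms(2)]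
  note sub = translates_span_subset_K_W[of scale ?\<rho> q, OF hyps]
    and zero = K_W_subset_span_q_zero[of scale ?\<rho> q, OF hyps]
    and nonzero = K_W_subset_span[of scale ?\<rho> q, OF hyps _ assms(1)]
  show ?thesis
    unfolding good_def using sub zero nonzero by (cases "q = 0") (simp_all only: subset_antisym simp_thms)
qed

end
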